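(* Let $\varepsilon>0$, $d = \mathcal{O}(\log n/\varepsilon^2)$ large enough, $m \le n$ with $d$ dividing both $m$ and $n$, $s = m/d$ a power of two, $k = \log_2 s$, and $t = \frac{n-m}{d}+1$. Given input $x\in\mathbb{R}^n$, let $y_1,\ldots,y_t\in\mathbb{R}^m$ be $y_i = (x_{1+(i-1)d},\ldots,x_{m+(i-1)d})$. For $\varepsilon \le \frac{1}{k}$, the procedure AllSketch (described below) outputs $v_1,\ldots,v_t\in\mathbb{R}^d$ such that $\|v_j\| = (1\pm\mathcal{O}(k\varepsilon))\|y_j\|$ with high probability, in time $\mathcal{O}\!\left(\frac{n\log^2 n}{\varepsilon}\right)$. Moreover, the map $y_i \mapsto v_i$ is linear and identical to the map $y_i \mapsto$ SingleSketch$(y_i)$ computed with the same maps $\varphi_1,\ldots,\varphi_k$.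
   Context: $\|\cdot\|$ is the Euclidean norm. A random map $\varphi:\mathbb{R}^d\times\mathbb{R}^d\to\mathbb{R}^d$ is drawn from the distribution $\mathcal{F}$: $\varphi(x,y)=A_0x+A_1y$ where $A_0,A_1$ are $d\times d$ matrices with entries in $\{-\frac{1}{\sqrt r},0,\frac1{\sqrt r}\}$, each column having exactly $r=\mathcal{O}(d\varepsilon)$ nonzero entries (sparse Johnson–Lindenstrauss matrices with random nonzero positions and uniformly random signs), so $\varphi$ is evaluated in $\mathcal{O}(d^2\varepsilon)$ time, and for any fixed $x,y\in\mathbb{R}^d$, $\Pr_{\varphi\sim\mathcal F}(\|\varphi(x,y)\|^2=(1\pm\varepsilon)(\|x\|^2+\|y\|^2)) = 1-n^{-\Omega(1)}$. Let $\varphi_1,\ldots,\varphi_k$ be fully independent maps drawn from $\mathcal{F}$. Procedure SingleSketch$(z)$ for $z\in\mathbb{R}^m$: partition $z$ into $s$ consecutive blocks $w^{(0)}_1,\ldots,w^{(0)}_s\in\mathbb{R}^d$; for $i=1,\ldots,k$, $j=1,\ldots,2^{k-i}$, set $w^{(i)}_j=\varphi_i(w^{(i-1)}_{2j-1},w^{(i-1)}_{2j})$; return $w^{(k)}_1$. Procedure AllSketch$(x)$: partition $x=(x_1,\ldots,x_n)$ into $n/d$ vectors $v^{(0)}_i = (x_{d(i-1)+1},\ldots,x_{di})$; for $i=1,\ldots,k$ and $j = 1,\ldots,\frac{n}{d}-2^i+1$ set $v^{(i)}_j = \varphi_i(v^{(i-1)}_j, v^{(i-1)}_{j+2^{i-1}})$;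 return $v^{(k)}_1,\ldots,v^{(k)}_t$. "With high probability" means with probability at least $1-n^{-\Omega(1)}$. *)

theory Defs
  imports
    "HOL-Probability.Probability"
    "HOL-Probability.Product_PMF"
    "HOL-Library.Monad_Syntax"
    "Jordan_Normal_Form.Matrix"
begin

no_notation Finite_Cartesian_Product.vec_nth (infixl \<open>$\<close> 90)
no_notation Inner_Product.real_inner_class.inner (infix \<open>\<bullet>\<close> 70)


text \<open>\<^bold>\<open>Sparse Johnson--Lindenstrauss maps.\<close>
  Vectors and matrices are those of Jordan Normal Form (dimension carried by the value).
  The uniform distribution on \<open>sjl_matrices d r\<close> is the one in which the columns are
  independent, the support of each column is a uniformly random \<open>r\<close>-subset of the rows, and the
  signs are independent and uniform.\<close>

definition sjl_matrices :: "nat \<Rightarrow> nat \<Rightarrow> real mat set" where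
  "sjl_matrices d r = {A \<in> carrier_mat d d.
     (\<forall>i<d. \<forall>j<d. A $$ (i, j) \<in> {- (1 / sqrt r), 0, 1 / sqrt r}) \<and>
     (\<forall>j<d. card {i. i < d \<and> A $$ (i, j) \<noteq> 0} = r)}"

definition sjl_dist :: "nat \<Rightarrow> nat \<Rightarrow> (real mat \<times> real mat) pmf" where
  "sjl_dist d r = pair_pmf (pmf_of_set (sjl_matrices d r)) (pmf_of_set (sjl_matrices d r))"

definition sketch_maps :: "nat \<Rightarrow> nat \<Rightarrow> nat \<Rightarrow> (nat \<Rightarrow> real mat \<times> real mat) pmf" where
  "sketch_maps k d r = Pi_pmf {1..k} undefined (\<lambda>_. sjl_dist d r)"

definition app_map :: "real mat \<times> real mat \<Rightarrow> real vec \<Rightarrow> real vec \<Rightarrow> real vec" where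
  "app_map A x y = fst A *\<^sub>v x + snd A *\<^sub>v y"

definition vnorm :: "real vec \<Rightarrow> real" where
  "vnorm v = sqrt (v \<bullet> v)"

definition vec_linear :: "nat \<Rightarrow> nat \<Rightarrow> (real vec \<Rightarrow> real vec) \<Rightarrow> bool" where
  "vec_linear m d f \<longleftrightarrow>
     (\<forall>u \<in> carrier_vec m. f u \<in> carrier_vec d) \<and>
     (\<forall>u \<in> carrier_vec m. \<forall>v \<in> carrier_vec m. f (u + v) = f u + f v) \<and>
     (\<forall>a. \<forall>u \<in> carrier_vec m. f (a \<cdot>\<^sub>v u) = a \<cdot>\<^sub>v f u)"


text \<open>\<^bold>\<open>The sketches.\<close>
  Blocks, windows, levels and maps are numbered from 1; the coordinates of a vector are numbered
  from 0. \<open>single_sketch_level d \<phi> z i j\<close> is $w^{(i)}_j$ and \<open>all_sketch_level d \<phi> x i j\<close> is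
  $v^{(i)}_j$; only indices \<open>j\<close> in the ranges of the two procedures are meaningful.\<close>

definition block :: "nat \<Rightarrow> real vec \<Rightarrow> nat \<Rightarrow> real vec" where
  "block d z j = vec d (\<lambda>l. z $ (d * (j - 1) + l))"

definition window :: "nat \<Rightarrow> nat \<Rightarrow> real vec \<Rightarrow> nat \<Rightarrow> real vec" where
  "window m d x j = vec m (\<lambda>l. x $ ((j - 1) * d + l))"

primrec single_sketch_level ::
    "nat \<Rightarrow> (nat \<Rightarrow> real mat \<times> real mat) \<Rightarrow> real vec \<Rightarrow> nat \<Rightarrow> nat \<Rightarrow> real vec" where
  "single_sketch_level d \<phi> z 0 = (\<lambda>j. block d z j)"
| "single_sketch_level d \<phi> z (Suc i) = (\<lambda>j.
     app_map (\<phi> (Suc i)) (single_sketch_level d \<phi> z i (2 * j - 1))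
                          (single_sketch_level d \<phi> z i (2 * j)))"

definition single_sketch ::
    "nat \<Rightarrow> nat \<Rightarrow> (nat \<Rightarrow> real mat \<times> real mat) \<Rightarrow> real vec \<Rightarrow> real vec" where
  "single_sketch k d \<phi> z = single_sketch_level d \<phi> z k 1"

primrec all_sketch_level ::
    "nat \<Rightarrow> (nat \<Rightarrow> real mat \<times> real mat) \<Rightarrow> real vec \<Rightarrow> nat \<Rightarrow> nat \<Rightarrow> real vec" where
  "all_sketch_level d \<phi> x 0 = (\<lambda>j. block d x j)"
| "all_sketch_level d \<phi> x (Suc i) = (\<lambda>j.
     app_map (\<phi> (Suc i)) (all_sketch_level d \<phi> x i j)
                          (all_sketch_level d \<phi> x i (j + 2 ^ i)))"

definition all_sketch ::
    "nat \<Rightarrow> nat \<Rightarrow> (nat \<Rightarrow> real mat \<times> real mat) \<Rightarrow> real vec \<Rightarrow> nat \<Rightarrow> real vec" where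
  "all_sketch k d \<phi> x j = all_sketch_level d \<phi> x k j"


text \<open>\<^bold>\<open>Running time.\<close>
  The procedure is written as a program on a random access machine with real and index registers,
  as a computation that returns its result together with the number of steps. Every arithmetic
  operation on reals or indices, every read or write of an array cell, and every loop iteration
  (including access to the current list element) is one step. Arrays are threaded linearly, so updates are in place.\<close>

datatype 'a tm = TM (val: 'a) (time: nat)

definition return_tm :: "'a \<Rightarrow> 'a tm" where
  "return_tm a = TM a 0"

definition bind_tm :: "'a tm \<Rightarrow> ('a \<Rightarrow> 'b tm) \<Rightarrow> 'b tm" where
  "bind_tm p f = TM (val (f (val p))) (time p + time (f (val p)))"

adhoc_overloading Monad_Syntax.bind \<rightleftharpoons> bind_tm

definition add_tm :: "'a::plus \<Rightarrow> 'a \<Rightarrow> 'a tm" where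
  "add_tm a b = TM (a + b) 1"

definition sub_tm :: "'a::minus \<Rightarrow> 'a \<Rightarrow> 'a tm" where
  "sub_tm a b = TM (a - b) 1"

definition mul_tm :: "'a::times \<Rightarrow> 'a \<Rightarrow> 'a tm" where
  "mul_tm a b = TM (a * b) 1"

definition new_tm :: "nat \<Rightarrow> real vec tm" where
  "new_tm l = TM (0\<^sub>v l) l"

definition read_tm :: "real vec \<Rightarrow> nat \<Rightarrow> real tm" where
  "read_tm v p = TM (v $ p) 1"

definition write_tm :: "real vec \<Rightarrow> nat \<Rightarrow> real \<Rightarrow> real vec tm" where
  "write_tm v p a = TM (vec (dim_vec v) (\<lambda>l. if l = p then a else v $ l)) 1"

primrec loop_tm :: "'b list \<Rightarrow> ('b \<Rightarrow> 's \<Rightarrow> 's tm) \<Rightarrow> 's \<Rightarrow> 's tm" where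
  "loop_tm [] body st = return_tm st"
| "loop_tm (b # bs) body st =
     do { _ \<leftarrow> TM () 1; st' \<leftarrow> body b st; loop_tm bs body st' }"

text \<open>The maps are part of the input and are stored sparsely, as lists of the triples
  (row, column, value) of their nonzero entries.\<close>

definition sparse_entries :: "real mat \<Rightarrow> (nat \<times> nat \<times> real) list" where
  "sparse_entries A =
     [(i, c, A $$ (i, c)). c \<leftarrow> [0..<dim_col A], i \<leftarrow> [0..<dim_row A], A $$ (i, c) \<noteq> 0]"

text \<open>Adds to the segment of \<open>out\<close> starting at \<open>dst\<close> the product of the stored matrix with the
  segment of \<open>inp\<close> starting at \<open>src\<close>.\<close>

definition mult_add_tm ::
    "(nat \<times> nat \<times> real) list \<Rightarrow> real vec \<Rightarrow> nat \<Rightarrow> nat \<Rightarrow> real vec \<Rightarrow> real vec tm" where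
  "mult_add_tm E inp src dst out =
     loop_tm E (\<lambda>(i, c, a) out. do {
       p \<leftarrow> add_tm src c;
       u \<leftarrow> read_tm inp p;
       q \<leftarrow> add_tm dst i;
       w \<leftarrow> read_tm out q;
       y \<leftarrow> mul_tm a u;
       z \<leftarrow> add_tm w y;
       write_tm out q z
     }) out"

text \<open>All vectors $v^{(i)}_1, v^{(i)}_2, \dots$ of a level are kept consecutively in one array, so
  the input array \<open>x\<close> itself is level 0. The state of the outer loop consists of the array of the
  current level, its number of vectors, and the shift $2^{i-1}$. The input
  consists of the number \<open>N\<close> of blocks, their length \<open>d\<close>, the list \<open>Es\<close> of the stored maps
  $\varphi_1, \dots, \varphi_k$, and \<open>x\<close>.\<close>

definition all_sketch_tm ::
    "nat \<Rightarrow> nat \<Rightarrow>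
     ((nat \<times> nat \<times> real) list \<times> (nat \<times> nat \<times> real) list) list \<Rightarrow> real vec \<Rightarrow>
     (real vec \<times> nat \<times> nat) tm" where
  "all_sketch_tm N d Es x =
     loop_tm Es (\<lambda>(E\<^sub>0, E\<^sub>1) (cur, cnt, h). do {
       cnt' \<leftarrow> sub_tm cnt h;
       len \<leftarrow> mul_tm cnt' d;
       nxt \<leftarrow> new_tm len;
       nxt \<leftarrow> loop_tm [0..<cnt'] (\<lambda>j nxt. do {
         p \<leftarrow> mul_tm d j;
         j' \<leftarrow> add_tm j h;
         p' \<leftarrow> mul_tm d j';
         nxt \<leftarrow> mult_add_tm E\<^sub>0 cur p p nxt;
         mult_add_tm E\<^sub>1 cur p' p nxt
       }) nxt;
       h' \<leftarrow> mul_tm 2 h;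
       return_tm (nxt, cnt', h')
     }) (x, N, 1)"

definition all_sketch_prog ::
    "nat \<Rightarrow> nat \<Rightarrow> nat \<Rightarrow> (nat \<Rightarrow> real mat \<times> real mat) \<Rightarrow> real vec \<Rightarrow> real vec tm" where
  "all_sketch_prog n k d \<phi> x =
     do { (out, _, _) \<leftarrow> all_sketch_tm (n div d) d
            (map (\<lambda>i. map_prod sparse_entries sparse_entries (\<phi> i)) [1..<k+1]) x;
          return_tm out }"

end

theory Submission
  imports Defs
begin

text \<open>
  Applied to a fixed vector \<open>u\<close>, a sparse sign matrix distorts the squared norm by the sum over its
  rows \<open>l\<close> of \<open>\<Sum>\<^sub>i\<^sub>\<noteq>\<^sub>j c\<^sub>i\<^sub>l c\<^sub>j\<^sub>l u\<^sub>i u\<^sub>j\<close>, because every column has norm 1. Conditionally on the supports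
  of the columns this is a sum of independent Rademacher chaoses. Averaging over the signs one at a
  time with \<open>cosh a \<le> exp (a\<^sup>2/2)\<close> bounds its moment generating function at \<open>\<bar>\<nu>\<bar> \<le> r/4\<close>, for a unit
  vector \<open>u\<close>, by \<open>E exp (4 (\<nu>/r)\<^sup>2 \<Sum>\<^sub>i\<^sub>\<noteq>\<^sub>j u\<^sub>i\<^sup>2 u\<^sub>j\<^sup>2 |S\<^sub>i \<inter> S\<^sub>j|)\<close>, where \<open>S\<^sub>i\<close> is the support of column
  \<open>i\<close>. Jensen's inequality reduces this to a single pair of columns, and the moment generating
  function of the hypergeometric variable \<open>|S\<^sub>i \<inter> S\<^sub>j|\<close> gives the bound \<open>exp (8 \<nu>\<^sup>2/d)\<close>. A Chernoff
  bound with \<open>\<nu> = 2L/\<epsilon>\<close> and \<open>L = (c + 3) ln n\<close> shows that a map distorts a fixed pair of vectors by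
  more than \<open>1 \<plusminus> \<epsilon>\<close> with probability at most \<open>2 n\<^sup>-\<^sup>(\<^sup>c\<^sup>+\<^sup>3\<^sup>)\<close>. Since \<open>\<phi>\<^sub>i\<close> is independent of the inputs
  of level \<open>i\<close>, a union bound over the at most \<open>n\<^sup>2\<close> vectors of AllSketch bounds all distortions,
  which compound over the \<open>k\<close> levels to \<open>(1 \<plusminus> \<epsilon>)\<^sup>k = 1 \<plusminus> O(k\<epsilon>)\<close>.
\<close>

section \<open>Distributions with finite support\<close>

lemma expectation_mono_pmf_finite:
  fixes f g :: "'a \<Rightarrow> real"
  assumes "finite (set_pmf p)" "\<And>x. x \<in> set_pmf p \<Longrightarrow> f x \<le> g x"
  shows "measure_pmf.expectation p f \<le> measure_pmf.expectation p g"
  using assms by (intro integral_mono_AE integrable_measure_pmf_finite AE_pmfI)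

lemma expectation_le_const_pmf_finite:
  fixes f :: "'a \<Rightarrow> real"
  assumes "finite (set_pmf p)" "\<And>x. x \<in> set_pmf p \<Longrightarrow> f x \<le> B"
  shows "measure_pmf.expectation p f \<le> B"
  using expectation_mono_pmf_finite[of p f "\<lambda>_. B"] assms by simp

lemma expectation_bind_pmf_finite:
  fixes h :: "'b \<Rightarrow> real"
  assumes "finite (set_pmf p)" "\<And>x. x \<in> set_pmf p \<Longrightarrow> finite (set_pmf (f x))"
  shows "measure_pmf.expectation (bind_pmf p f) h =
    measure_pmf.expectation p (\<lambda>x. measure_pmf.expectation (f x) h)"
  using assms by (simp add: pmf_expectation_bind integral_measure_pmf[of "set_pmf p"])

lemma expectation_swap_pmf_finite:
  fixes f :: "'a \<Rightarrow> 'b \<Rightarrow> real"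
  assumes "finite (set_pmf p)" "finite (set_pmf q)"
  shows "measure_pmf.expectation p (\<lambda>x. measure_pmf.expectation q (f x)) =
    measure_pmf.expectation q (\<lambda>y. measure_pmf.expectation p (\<lambda>x. f x y))"
proof -
  have "measure_pmf.expectation p (\<lambda>x. measure_pmf.expectation q (f x)) =
      (\<Sum>x\<in>set_pmf p. \<Sum>y\<in>set_pmf q. pmf p x * pmf q y * f x y)"
    using assms by (simp add: integral_measure_pmf[of "set_pmf p"]
        integral_measure_pmf[of "set_pmf q"] sum_distrib_left mult.assoc)
  also have "\<dots> = (\<Sum>y\<in>set_pmf q. \<Sum>x\<in>set_pmf p. pmf p x * pmf q y * f x y)"
    by (rule sum.swap)
  also have "\<dots> = measure_pmf.expectation q (\<lambda>y. measure_pmf.expectation p (\<lambda>x. f x y))"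
    using assms by (simp add: integral_measure_pmf[of "set_pmf p"]
        integral_measure_pmf[of "set_pmf q"] sum_distrib_left mult_ac)
  finally show ?thesis .
qed

lemma expectation_symmetrise_pmf_finite:
  fixes F :: "'a \<Rightarrow> real"
  assumes "finite (set_pmf p)" "finite (set_pmf q)"
    and invariant: "\<And>\<sigma>. \<sigma> \<in> set_pmf q \<Longrightarrow> map_pmf (act \<sigma>) p = p"
  shows "measure_pmf.expectation p F =
    measure_pmf.expectation p (\<lambda>x. measure_pmf.expectation q (\<lambda>\<sigma>. F (act \<sigma> x)))"
proof -
  have "measure_pmf.expectation p F = measure_pmf.expectation q (\<lambda>\<sigma>. measure_pmf.expectation p F)"
    by simp
  also have "\<dots> = measure_pmf.expectation q (\<lambda>\<sigma>. measure_pmf.expectation p (\<lambda>x. F (act \<sigma> x)))"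
  proof (rule integral_cong_AE; (rule AE_pmfI)?)
    fix \<sigma> assume "\<sigma> \<in> set_pmf q"
    then show "measure_pmf.expectation p F = measure_pmf.expectation p (\<lambda>x. F (act \<sigma> x))"
      by (metis invariant integral_map_pmf)
  qed auto
  also have "\<dots> = measure_pmf.expectation p (\<lambda>x. measure_pmf.expectation q (\<lambda>\<sigma>. F (act \<sigma> x)))"
    by (rule expectation_swap_pmf_finite[OF assms(2,1)])
  finally show ?thesis .
qed

lemma finite_set_Pi_pmf:
  assumes "finite A" "\<And>x. x \<in> A \<Longrightarrow> finite (set_pmf (p x))"
  shows "finite (set_pmf (Pi_pmf A dflt p))"
  using assms by (simp add: set_Pi_pmf finite_PiE_dflt)

lemma expectation_Pi_pmf_insert:
  fixes g :: "('a \<Rightarrow> 'b) \<Rightarrow> real"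
  assumes "finite A" "x \<notin> A" "\<And>y. y \<in> insert x A \<Longrightarrow> finite (set_pmf (p y))"
  shows "measure_pmf.expectation (Pi_pmf (insert x A) dflt p) g =
    measure_pmf.expectation (Pi_pmf A dflt p)
      (\<lambda>f. measure_pmf.expectation (p x) (\<lambda>y. g (f(x := y))))"
proof -
  have "finite (set_pmf (p x))" "finite (set_pmf (Pi_pmf A dflt p))"
    using assms by (auto intro: finite_set_Pi_pmf)
  then show ?thesis
    using assms(1,2)
    by (simp add: Pi_pmf_insert' expectation_bind_pmf_finite expectation_swap_pmf_finite[of "p x"])
qed

lemma expectation_Pi_pmf_le_conditional:
  fixes g :: "('a \<Rightarrow> 'b) \<Rightarrow> real"
  assumes "finite I" "i \<in> I" and fin: "\<And>j. j \<in> I \<Longrightarrow> finite (set_pmf (p j))"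
    and le: "\<And>f. f \<in> set_pmf (Pi_pmf (I - {i}) dflt p) \<Longrightarrow>
      measure_pmf.expectation (p i) (\<lambda>a. g (f(i := a))) \<le> B"
  shows "measure_pmf.expectation (Pi_pmf I dflt p) g \<le> B"
proof -
  have "measure_pmf.expectation (Pi_pmf (insert i (I - {i})) dflt p) g =
    measure_pmf.expectation (Pi_pmf (I - {i}) dflt p)
      (\<lambda>f. measure_pmf.expectation (p i) (\<lambda>a. g (f(i := a))))"
    using assms by (intro expectation_Pi_pmf_insert) auto
  also have "\<dots> \<le> B"
    using assms(1) fin by (intro expectation_le_const_pmf_finite finite_set_Pi_pmf le) auto
  finally show ?thesis
    using assms(2) by (simp add: insert_absorb)
qed

lemma prob_Pi_pmf_le_conditional:
  assumes "finite I" "i \<in> I" "\<And>j. j \<in> I \<Longrightarrow> finite (set_pmf (p j))"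
    and "\<And>f. f \<in> set_pmf (Pi_pmf (I - {i}) dflt p) \<Longrightarrow>
      measure_pmf.prob (p i) {a. E (f(i := a))} \<le> B"
  shows "measure_pmf.prob (Pi_pmf I dflt p) {f. E f} \<le> B"
proof -
  have indicator: "measure_pmf.prob q {x. Q x} = measure_pmf.expectation q (\<lambda>x. of_bool (Q x))"
    for q :: "'c pmf" and Q
    by (simp add: of_bool_def flip: indicator_def[of "{x. Q x}", simplified])
  show ?thesis
    using assms unfolding indicator by (rule expectation_Pi_pmf_le_conditional)
qed

lemma Chernoff_two_sided_pmf_finite:
  fixes X :: "'a \<Rightarrow> real"
  assumes "finite (set_pmf p)" "0 < s"
    and mgf: "measure_pmf.expectation p (\<lambda>x. exp (s * X x)) \<le> B"
      "measure_pmf.expectation p (\<lambda>x. exp (- s * X x)) \<le> B"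
  shows "measure_pmf.prob p {x. a < \<bar>X x\<bar>} \<le> 2 * (exp (- s * a) * B)"
proof -
  have integrable: "integrable (measure_pmf p) f" for f :: "'a \<Rightarrow> real"
    using assms(1) by (rule integrable_measure_pmf_finite)
  have "measure_pmf.prob p {x. a \<le> X x} \<le> exp (- s * a) * B"
    using measure_pmf.Chernoff_ineq_ge[of s p UNIV X a] assms(2) mgf(1) integrable
    by (force simp: set_integrable_def set_lebesgue_integral_def intro: order_trans)
  moreover have "measure_pmf.prob p {x. X x \<le> - a} \<le> exp (- s * a) * B"
    using measure_pmf.Chernoff_ineq_le[of s p UNIV X "- a"] assms(2) mgf(2) integrable
    by (force simp: set_integrable_def set_lebesgue_integral_def intro: order_trans)
  moreover have "measure_pmf.prob p {x. a < \<bar>X x\<bar>}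
      \<le> measure_pmf.prob p ({x. a \<le> X x} \<union> {x. X x \<le> - a})"
    by (intro measure_pmf.finite_measure_mono) auto
  moreover have "\<dots> \<le> measure_pmf.prob p {x. a \<le> X x} + measure_pmf.prob p {x. X x \<le> - a}"
    by (intro measure_Un_le) auto
  ultimately show ?thesis by linarith
qed

lemma exp_weighted_sum_le:
  fixes w X :: "'a \<Rightarrow> real"
  assumes "\<And>i. i \<in> I \<Longrightarrow> 0 \<le> w i" "sum w I \<le> 1"
  shows "exp (\<Sum>i\<in>I. w i * X i) \<le> 1 - sum w I + (\<Sum>i\<in>I. w i * exp (X i))"
proof -
  define a where "a = (\<Sum>i\<in>I. w i * X i)"
  have tangent: "exp a * (1 + x - a) \<le> exp x" for x
    using exp_ge_add_one_self[of "x - a"] mult_left_mono[of "1 + (x - a)" "exp (x - a)" "exp a"]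
    by (simp flip: exp_add add: add_diff_eq)
  have "exp a = (1 - sum w I) * (exp a * (1 + 0 - a)) + (\<Sum>i\<in>I. w i * (exp a * (1 + X i - a)))"
    by (simp add: algebra_simps sum.distrib sum_subtractf flip: sum_distrib_left sum_distrib_right)
      (simp add: a_def sum_distrib_left mult_ac)
  also have "\<dots> \<le> (1 - sum w I) * exp 0 + (\<Sum>i\<in>I. w i * exp (X i))"
    using assms by (intro add_mono mult_left_mono sum_mono tangent) auto
  finally show ?thesis by (simp add: a_def)
qed

lemma expectation_exp_weighted_sum_le:
  fixes w :: "'i \<Rightarrow> real" and X :: "'i \<Rightarrow> 'a \<Rightarrow> real"
  assumes "finite (set_pmf p)" and w: "\<And>i. i \<in> I \<Longrightarrow> 0 \<le> w i" "sum w I \<le> 1"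
    and "1 \<le> B" and mgf: "\<And>i. i \<in> I \<Longrightarrow> measure_pmf.expectation p (\<lambda>x. exp (X i x)) \<le> B"
  shows "measure_pmf.expectation p (\<lambda>x. exp (\<Sum>i\<in>I. w i * X i x)) \<le> B"
proof -
  have integrable: "integrable (measure_pmf p) f" for f :: "'a \<Rightarrow> real"
    using assms(1) by (rule integrable_measure_pmf_finite)
  have "measure_pmf.expectation p (\<lambda>x. exp (\<Sum>i\<in>I. w i * X i x))
      \<le> measure_pmf.expectation p (\<lambda>x. 1 - sum w I + (\<Sum>i\<in>I. w i * exp (X i x)))"
    using assms(1) w by (intro expectation_mono_pmf_finite exp_weighted_sum_le)
  also have "\<dots> = 1 - sum w I + (\<Sum>i\<in>I. w i * measure_pmf.expectation p (\<lambda>x. exp (X i x)))"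
    by (simp add: integrable)
  also have "\<dots> \<le> (1 - sum w I) * B + (\<Sum>i\<in>I. w i * B)"
    using w mgf \<open>1 \<le> B\<close> mult_left_mono[of 1 B "1 - sum w I"]
    by (intro add_mono sum_mono mult_left_mono) auto
  also have "\<dots> = B"
    by (simp add: left_diff_distrib flip: sum_distrib_right)
  finally show ?thesis .
qed

lemma map_pmf_of_set_involution:
  assumes "finite A" "A \<noteq> {}" "\<And>x. x \<in> A \<Longrightarrow> f x \<in> A" "\<And>x. x \<in> A \<Longrightarrow> f (f x) = x"
  shows "map_pmf f (pmf_of_set A) = pmf_of_set A"
  using assms by (intro map_pmf_of_set_bij_betw bij_betw_byWitness[where f' = f]) auto

lemma pair_pmf_of_set:
  assumes "finite A" "A \<noteq> {}" "finite B" "B \<noteq> {}"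
  shows "pair_pmf (pmf_of_set A) (pmf_of_set B) = pmf_of_set (A \<times> B)"
  using assms
  by (intro pmf_eqI) (clarsimp simp: pmf_pair pmf_of_set card_cartesian_product indicator_def)

section \<open>Rademacher chaos\<close>

definition cross_sum :: "'a set \<Rightarrow> ('a \<Rightarrow> real) \<Rightarrow> real" where
  "cross_sum J f = (\<Sum>(i, j)\<in>Sigma J (\<lambda>i. J - {i}). f i * f j)"

lemma cross_sum_eq:
  assumes "finite J"
  shows "cross_sum J f = (\<Sum>j\<in>J. f j)\<^sup>2 - (\<Sum>j\<in>J. (f j)\<^sup>2)"
proof -
  have "cross_sum J f = (\<Sum>i\<in>J. \<Sum>j\<in>J - {i}. f i * f j)"
    using assms by (simp add: cross_sum_def sum.Sigma)
  also have "\<dots> = (\<Sum>i\<in>J. (\<Sum>j\<in>J. f i * f j) - f i * f i)"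
    using assms by (intro sum.cong refl) (simp add: sum_diff1)
  finally show ?thesis
    by (simp add: sum_subtractf power2_eq_square sum_product)
qed

lemma cross_sum_empty [simp]: "cross_sum {} f = 0"
  by (simp add: cross_sum_def)

lemma cross_sum_insert:
  assumes "finite J" "i \<notin> J"
  shows "cross_sum (insert i J) f = cross_sum J f + 2 * f i * (\<Sum>j\<in>J. f j)"
  using assms by (simp add: cross_sum_eq power2_sum)

lemma cross_sum_cong:
  assumes "\<And>j. j \<in> J \<Longrightarrow> f j = g j"
  shows "cross_sum J f = cross_sum J g"
  unfolding cross_sum_def using assms by (intro sum.cong) auto

lemma cosh_le_exp_square_half:
  fixes x :: real
  shows "cosh x \<le> exp (x\<^sup>2 / 2)"
proof -
  have nonneg: "cosh y \<le> exp (y\<^sup>2 / 2)" if "0 \<le> y" for y :: real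
  proof -
    define a where "a = 1 + 1 / 2 * (exp (2 * y) - 1)"
    have "0 < a"
      by (simp add: a_def algebra_simps add_pos_pos)
    have "ln a \<le> y + y\<^sup>2 / 2"
      using Hoeffdings_lemma_aux[of "2 * y" "1 / 2"] that
      by (simp add: a_def power2_eq_square)
    then have "a \<le> exp (y + y\<^sup>2 / 2)"
      using \<open>0 < a\<close> by (metis exp_le_cancel_iff exp_ln)
    then have "exp (- y) * a \<le> exp (- y) * exp (y + y\<^sup>2 / 2)"
      by simp
    moreover have "cosh y = exp (- y) * a"
      by (simp add: a_def cosh_field_def algebra_simps flip: exp_add)
    ultimately show ?thesis
      by (simp flip: exp_add)
  qed
  show ?thesis
    using nonneg[of "\<bar>x\<bar>"] by simp
qed

definition rademacher :: "real pmf" where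
  "rademacher = pmf_of_set {- 1, 1}"

lemma set_rademacher [simp]: "set_pmf rademacher = {- 1, 1}"
  by (simp add: rademacher_def)

lemma expectation_exp_rademacher_le:
  "measure_pmf.expectation rademacher (\<lambda>y. exp (a + b * y)) \<le> exp (a + b\<^sup>2 / 2)"
proof -
  have "measure_pmf.expectation rademacher (\<lambda>y. exp (a + b * y)) = exp a * cosh b"
    by (simp add: rademacher_def integral_pmf_of_set cosh_field_def exp_add exp_diff exp_minus
        field_simps)
  also have "\<dots> \<le> exp a * exp (b\<^sup>2 / 2)"
    by (intro mult_left_mono cosh_le_exp_square_half) simp
  finally show ?thesis by (simp add: exp_add)
qed

text \<open>The default value 1, in place of 0, makes every entry of a sign vector a sign.\<close>

definition sign_vector :: "'a set \<Rightarrow> ('a \<Rightarrow> real) pmf" where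
  "sign_vector J = Pi_pmf J 1 (\<lambda>_. rademacher)"

lemma finite_set_sign_vector: "finite J \<Longrightarrow> finite (set_pmf (sign_vector J))"
  unfolding sign_vector_def by (intro finite_set_Pi_pmf) auto

lemma abs_sign_vector:
  assumes "finite J" "s \<in> set_pmf (sign_vector J)"
  shows "\<bar>s j\<bar> = 1"
proof (cases "j \<in> J")
  case True
  then have "s j \<in> {- 1, 1}"
    using assms by (auto simp: sign_vector_def set_Pi_pmf PiE_dflt_def)
  then show ?thesis by auto
qed (use assms in \<open>auto simp: sign_vector_def set_Pi_pmf PiE_dflt_def\<close>)

text \<open>Averaging over the sign of index \<open>i\<close> replaces \<open>\<mu>\<close> by \<open>\<mu> + 2\<mu>\<^sup>2b\<^sub>i\<^sup>2\<close>. The hypothesis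
  \<open>\<bar>\<mu>\<bar> \<le> \<Lambda> (1 - 2\<bar>\<mu>\<bar>V)\<close>, with \<open>V = \<Sum>b\<^sub>j\<^sup>2\<close>, survives this because \<open>V\<close> loses \<open>b\<^sub>i\<^sup>2\<close> at the same time.\<close>

lemma chaos_coefficient_step:
  fixes \<mu> \<Lambda> a V :: real
  assumes "0 \<le> \<Lambda>" "0 \<le> a" "0 \<le> V" "\<bar>\<mu>\<bar> \<le> \<Lambda> * (1 - 2 * \<bar>\<mu>\<bar> * (a + V))"
  defines "\<mu>' \<equiv> \<mu> + 2 * \<mu>\<^sup>2 * a"
  shows "\<bar>\<mu>'\<bar> \<le> \<Lambda> * (1 - 2 * \<bar>\<mu>'\<bar> * V)" and "\<mu>\<^sup>2 \<le> \<Lambda>\<^sup>2"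
proof -
  define y where "y = 2 * \<bar>\<mu>\<bar> * a"
  have y: "0 \<le> y" using assms by (simp add: y_def)
  have "\<bar>\<mu>'\<bar> \<le> \<bar>\<mu>\<bar> + \<bar>2 * \<mu>\<^sup>2 * a\<bar>"
    unfolding \<mu>'_def by (rule abs_triangle_ineq)
  also have "\<dots> = \<bar>\<mu>\<bar> * (1 + y)"
    using assms(2) by (simp add: y_def abs_mult power2_eq_square algebra_simps)
  finally have \<mu>': "\<bar>\<mu>'\<bar> \<le> \<bar>\<mu>\<bar> * (1 + y)" .
  also have "\<dots> \<le> \<Lambda> * (1 - y - 2 * \<bar>\<mu>\<bar> * V) * (1 + y)"
    using assms(4) y by (intro mult_right_mono) (auto simp: y_def algebra_simps)
  also have "\<dots> \<le> \<Lambda> * (1 - 2 * (\<bar>\<mu>\<bar> * (1 + y)) * V)"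
    unfolding mult.assoc using assms(1) y
    by (intro mult_left_mono) (auto simp: algebra_simps)
  also have "\<dots> \<le> \<Lambda> * (1 - 2 * \<bar>\<mu>'\<bar> * V)"
    using \<mu>' assms(1,3) by (intro mult_left_mono diff_left_mono mult_right_mono) auto
  finally show "\<bar>\<mu>'\<bar> \<le> \<Lambda> * (1 - 2 * \<bar>\<mu>'\<bar> * V)" .
  have "\<Lambda> * (1 - 2 * \<bar>\<mu>\<bar> * (a + V)) \<le> \<Lambda> * 1"
    using assms(1-3) by (intro mult_left_mono) auto
  then show "\<mu>\<^sup>2 \<le> \<Lambda>\<^sup>2"
    using assms(1,4) by (intro abs_le_square_iff[THEN iffD1]) simp
qed

lemma expectation_exp_cross_sum_insert_le:
  fixes b s :: "'a \<Rightarrow> real"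
  assumes "finite J" "i \<notin> J" and s: "\<And>j. j \<in> J \<Longrightarrow> \<bar>s j\<bar> = 1"
  shows "measure_pmf.expectation rademacher
      (\<lambda>y. exp (\<mu> * cross_sum (insert i J) (\<lambda>j. (s(i := y)) j * b j)))
    \<le> exp (\<mu>\<^sup>2 * (2 * (b i)\<^sup>2 * (\<Sum>j\<in>J. (b j)\<^sup>2)))
      * exp ((\<mu> + 2 * \<mu>\<^sup>2 * (b i)\<^sup>2) * cross_sum J (\<lambda>j. s j * b j))"
proof -
  define C where "C = cross_sum J (\<lambda>j. s j * b j)"
  define G where "G = (\<Sum>j\<in>J. s j * b j)"
  have "(s j * b j)\<^sup>2 = (b j)\<^sup>2" if "j \<in> J" for j
    using s[OF that] by (metis abs_mult mult_1 power2_abs)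
  then have G_power2: "G\<^sup>2 = (\<Sum>j\<in>J. (b j)\<^sup>2) + C"
    using assms(1) by (simp add: G_def C_def cross_sum_eq)
  have "cross_sum J (\<lambda>j. (s(i := y)) j * b j) = C" "(\<Sum>j\<in>J. (s(i := y)) j * b j) = G" for y
    unfolding C_def G_def using assms(2) by (auto intro!: cross_sum_cong sum.cong)
  then have "measure_pmf.expectation rademacher
      (\<lambda>y. exp (\<mu> * cross_sum (insert i J) (\<lambda>j. (s(i := y)) j * b j)))
    = measure_pmf.expectation rademacher (\<lambda>y. exp (\<mu> * C + 2 * \<mu> * b i * G * y))"
    using assms(1,2) by (simp add: cross_sum_insert algebra_simps)
  also have "\<dots> \<le> exp (\<mu> * C + (2 * \<mu> * b i * G)\<^sup>2 / 2)"
    by (rule expectation_exp_rademacher_le)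
  also have "\<dots> = exp (\<mu>\<^sup>2 * (2 * (b i)\<^sup>2 * (\<Sum>j\<in>J. (b j)\<^sup>2))) * exp ((\<mu> + 2 * \<mu>\<^sup>2 * (b i)\<^sup>2) * C)"
    by (simp add: power_mult_distrib G_power2 algebra_simps flip: exp_add)
  finally show ?thesis by (simp add: C_def)
qed

lemma rademacher_chaos_mgf:
  fixes b :: "'a \<Rightarrow> real"
  assumes "finite J" "0 \<le> \<Lambda>" "\<bar>\<mu>\<bar> \<le> \<Lambda> * (1 - 2 * \<bar>\<mu>\<bar> * (\<Sum>j\<in>J. (b j)\<^sup>2))"
  shows "measure_pmf.expectation (sign_vector J) (\<lambda>s. exp (\<mu> * cross_sum J (\<lambda>j. s j * b j)))
    \<le> exp (\<Lambda>\<^sup>2 * cross_sum J (\<lambda>j. (b j)\<^sup>2))"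
  using assms(1,3)
proof (induction J arbitrary: \<mu> rule: finite_induct)
  case empty
  then show ?case by simp
next
  case (insert i J)
  define V where "V = (\<Sum>j\<in>J. (b j)\<^sup>2)"
  define \<mu>' where "\<mu>' = \<mu> + 2 * \<mu>\<^sup>2 * (b i)\<^sup>2"
  have "0 \<le> V" by (simp add: V_def sum_nonneg)
  then have \<mu>': "\<bar>\<mu>'\<bar> \<le> \<Lambda> * (1 - 2 * \<bar>\<mu>'\<bar> * V)" and \<mu>: "\<mu>\<^sup>2 \<le> \<Lambda>\<^sup>2"
    unfolding \<mu>'_def using insert chaos_coefficient_step[OF assms(2) zero_le_power2[of "b i"]]
    by (auto simp: V_def)
  have "measure_pmf.expectation (sign_vector (insert i J))
      (\<lambda>s. exp (\<mu> * cross_sum (insert i J) (\<lambda>j. s j * b j)))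
    = measure_pmf.expectation (sign_vector J) (\<lambda>s. measure_pmf.expectation rademacher
        (\<lambda>y. exp (\<mu> * cross_sum (insert i J) (\<lambda>j. (s(i := y)) j * b j))))"
    using insert.hyps unfolding sign_vector_def by (intro expectation_Pi_pmf_insert) auto
  also have "\<dots> \<le> measure_pmf.expectation (sign_vector J)
      (\<lambda>s. exp (\<mu>\<^sup>2 * (2 * (b i)\<^sup>2 * V)) * exp (\<mu>' * cross_sum J (\<lambda>j. s j * b j)))"
    unfolding V_def \<mu>'_def using insert.hyps
    by (intro expectation_mono_pmf_finite finite_set_sign_vector
        expectation_exp_cross_sum_insert_le abs_sign_vector)
  also have "\<dots> = exp (\<mu>\<^sup>2 * (2 * (b i)\<^sup>2 * V))
      * measure_pmf.expectation (sign_vector J) (\<lambda>s. exp (\<mu>' * cross_sum J (\<lambda>j. s j * b j)))"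
    by simp
  also have "\<dots> \<le> exp (\<Lambda>\<^sup>2 * (2 * (b i)\<^sup>2 * V)) * exp (\<Lambda>\<^sup>2 * cross_sum J (\<lambda>j. (b j)\<^sup>2))"
    using insert.IH[of \<mu>'] \<mu>' mult_right_mono[OF \<mu>, of "2 * (b i)\<^sup>2 * V"] \<open>0 \<le> V\<close>
    by (intro mult_mono) (auto simp: V_def)
  also have "\<dots> = exp (\<Lambda>\<^sup>2 * cross_sum (insert i J) (\<lambda>j. (b j)\<^sup>2))"
    using insert.hyps by (simp add: cross_sum_insert V_def algebra_simps flip: exp_add)
  finally show ?case .
qed

definition sign_matrix :: "'a set \<Rightarrow> 'b set \<Rightarrow> ('b \<Rightarrow> 'a \<Rightarrow> real) pmf" where
  "sign_matrix J R = Pi_pmf R (\<lambda>_. 1) (\<lambda>_. sign_vector J)"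

lemma finite_set_sign_matrix:
  "finite J \<Longrightarrow> finite R \<Longrightarrow> finite (set_pmf (sign_matrix J R))"
  unfolding sign_matrix_def by (intro finite_set_Pi_pmf finite_set_sign_vector)

lemma abs_sign_matrix:
  assumes "finite J" "finite R" "\<sigma> \<in> set_pmf (sign_matrix J R)"
  shows "\<bar>\<sigma> l j\<bar> = 1"
  using assms abs_sign_vector[OF assms(1), of "\<sigma> l" j]
  by (cases "l \<in> R") (auto simp: sign_matrix_def set_Pi_pmf PiE_dflt_def)

lemma sign_matrix_chaos_mgf:
  fixes a :: "'b \<Rightarrow> 'a \<Rightarrow> real"
  assumes "finite J" "finite R" "0 \<le> \<Lambda>"
    and "\<And>l. l \<in> R \<Longrightarrow> \<bar>\<nu>\<bar> \<le> \<Lambda> * (1 - 2 * \<bar>\<nu>\<bar> * (\<Sum>j\<in>J. (a l j)\<^sup>2))"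
  shows "measure_pmf.expectation (sign_matrix J R)
      (\<lambda>\<sigma>. exp (\<nu> * (\<Sum>l\<in>R. cross_sum J (\<lambda>j. \<sigma> l j * a l j))))
    \<le> exp (\<Lambda>\<^sup>2 * (\<Sum>l\<in>R. cross_sum J (\<lambda>j. (a l j)\<^sup>2)))"
proof -
  have "measure_pmf.expectation (sign_matrix J R)
      (\<lambda>\<sigma>. exp (\<nu> * (\<Sum>l\<in>R. cross_sum J (\<lambda>j. \<sigma> l j * a l j))))
    = measure_pmf.expectation (sign_matrix J R)
      (\<lambda>\<sigma>. \<Prod>l\<in>R. exp (\<nu> * cross_sum J (\<lambda>j. \<sigma> l j * a l j)))"
    using assms(2) by (simp add: sum_distrib_left exp_sum)
  also have "\<dots> = (\<Prod>l\<in>R. measure_pmf.expectation (sign_vector J)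
      (\<lambda>s. exp (\<nu> * cross_sum J (\<lambda>j. s j * a l j))))"
    unfolding sign_matrix_def using assms(1,2)
    by (intro expectation_prod_Pi_pmf integrable_measure_pmf_finite finite_set_sign_vector) auto
  also have "\<dots> \<le> (\<Prod>l\<in>R. exp (\<Lambda>\<^sup>2 * cross_sum J (\<lambda>j. (a l j)\<^sup>2)))"
    using assms by (intro prod_mono conjI rademacher_chaos_mgf) auto
  also have "\<dots> = exp (\<Lambda>\<^sup>2 * (\<Sum>l\<in>R. cross_sum J (\<lambda>j. (a l j)\<^sup>2)))"
    using assms(2) by (simp add: sum_distrib_left exp_sum)
  finally show ?thesis .
qed

section \<open>Random sparse columns\<close>

definition supp :: "('a \<Rightarrow> real) \<Rightarrow> 'a set" where
  "supp v = {l. v l \<noteq> 0}"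

definition sparse_columns :: "'a set \<Rightarrow> nat \<Rightarrow> ('a \<Rightarrow> real) set" where
  "sparse_columns R r =
     {v. supp v \<subseteq> R \<and> card (supp v) = r \<and> (\<forall>l\<in>supp v. \<bar>v l\<bar> = 1 / sqrt r)}"

lemma sparse_columns_iff_PiE_dflt:
  assumes "S \<subseteq> R" "card S = r" "0 < r"
  shows "v \<in> sparse_columns R r \<and> supp v = S \<longleftrightarrow>
    v \<in> PiE_dflt S 0 (\<lambda>_. {- (1 / sqrt r), 1 / sqrt r})"
proof
  assume "v \<in> sparse_columns R r \<and> supp v = S"
  then show "v \<in> PiE_dflt S 0 (\<lambda>_. {- (1 / sqrt r), 1 / sqrt r})"
    by (force simp: sparse_columns_def PiE_dflt_def supp_def abs_if split: if_splits)
next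
  assume v: "v \<in> PiE_dflt S 0 (\<lambda>_. {- (1 / sqrt r), 1 / sqrt r})"
  then have "supp v = S"
    using assms(3) by (force simp: PiE_dflt_def supp_def)
  then show "v \<in> sparse_columns R r \<and> supp v = S"
    using v assms by (auto simp: sparse_columns_def PiE_dflt_def)
qed

lemma finite_sparse_columns:
  assumes "finite R"
  shows "finite (sparse_columns R r)"
proof (rule finite_subset)
  show "sparse_columns R r \<subseteq> PiE_dflt R 0 (\<lambda>_. {- (1 / sqrt r), 0, 1 / sqrt r})"
    by (force simp: sparse_columns_def PiE_dflt_def supp_def abs_if split: if_splits)
qed (use assms in \<open>auto intro!: finite_PiE_dflt\<close>)

lemma sparse_columns_nonempty:
  assumes "0 < r" "r \<le> card R"
  shows "sparse_columns R r \<noteq> {}"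
proof -
  obtain S where S: "S \<subseteq> R" "card S = r"
    using assms(2) by (meson obtain_subset_with_card_n)
  have "(\<lambda>l. if l \<in> S then 1 / sqrt r else 0) \<in> PiE_dflt S 0 (\<lambda>_. {- (1 / sqrt r), 1 / sqrt r})"
    by (simp add: PiE_dflt_def)
  then show ?thesis
    using sparse_columns_iff_PiE_dflt[OF S assms(1)] by blast
qed

lemma sparse_columns_power2:
  assumes "v \<in> sparse_columns R r"
  shows "(v l)\<^sup>2 = (if l \<in> supp v then 1 / r else 0)"
proof (cases "l \<in> supp v")
  case True
  then have "\<bar>v l\<bar>\<^sup>2 = 1 / r"
    using assms by (simp add: sparse_columns_def power_divide)
  then show ?thesis using True by simp
qed (simp add: supp_def)

lemma sparse_columns_sum_power2:
  assumes "finite R" "0 < r" "v \<in> sparse_columns R r"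
  shows "(\<Sum>l\<in>R. (v l)\<^sup>2) = 1"
proof -
  have "R \<inter> supp v = supp v" using assms(3) by (auto simp: sparse_columns_def)
  then show ?thesis
    using assms by (simp add: sparse_columns_power2[OF assms(3)] sum.If_cases sparse_columns_def)
qed

lemma sparse_columns_sum_power2_mult:
  assumes "finite R" "v \<in> sparse_columns R r" "w \<in> sparse_columns R r"
  shows "(\<Sum>l\<in>R. (v l)\<^sup>2 * (w l)\<^sup>2) = card (supp w \<inter> supp v) / (real r)\<^sup>2"
proof -
  have "(\<Sum>l\<in>R. (v l)\<^sup>2 * (w l)\<^sup>2) = (\<Sum>l\<in>R. if l \<in> supp w \<inter> supp v then 1 / (real r)\<^sup>2 else 0)"
    by (intro sum.cong refl)
      (auto simp: assms(2,3)[THEN sparse_columns_power2] power2_eq_square[of "real r"])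
  also have "R \<inter> (supp w \<inter> supp v) = supp w \<inter> supp v"
    using assms(2) by (auto simp: sparse_columns_def)
  then have "(\<Sum>l\<in>R. if l \<in> supp w \<inter> supp v then 1 / (real r)\<^sup>2 else 0)
      = card (supp w \<inter> supp v) / (real r)\<^sup>2"
    using assms(1) by (subst sum.If_cases) (simp_all add: Int_def)
  finally show ?thesis .
qed

lemma sparse_columns_sign_flip:
  assumes "v \<in> sparse_columns R r" "\<And>l. \<bar>\<sigma> l\<bar> = 1"
  shows "(\<lambda>l. \<sigma> l * v l) \<in> sparse_columns R r"
proof -
  have "\<sigma> l \<noteq> 0" for l using assms(2)[of l] by auto
  then have "supp (\<lambda>l. \<sigma> l * v l) = supp v" by (auto simp: supp_def)
  then show ?thesis
    using assms by (simp add: sparse_columns_def abs_mult)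
qed

lemma card_subsets_between:
  assumes "finite R" "U \<subseteq> R" "card U \<le> r"
  shows "card {S. U \<subseteq> S \<and> S \<subseteq> R \<and> card S = r} = (card R - card U) choose (r - card U)"
proof -
  have finU: "finite U" using assms finite_subset by blast
  have "bij_betw (\<lambda>S. S \<union> U) {S. S \<subseteq> R - U \<and> card S = r - card U}
      {S. U \<subseteq> S \<and> S \<subseteq> R \<and> card S = r}"
  proof (rule bij_betw_byWitness[where f' = "\<lambda>S. S - U"])
    show "(\<lambda>S. S \<union> U) ` {S. S \<subseteq> R - U \<and> card S = r - card U}
        \<subseteq> {S. U \<subseteq> S \<and> S \<subseteq> R \<and> card S = r}"
    proof safe
      fix S assume S: "S \<subseteq> R - U" "card S = r - card U"
      then have "card (S \<union> U) = card S + card U"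
        using assms(1) finU by (intro card_Un_disjoint) (auto intro: finite_subset)
      then show "card (S \<union> U) = r" using S assms(3) by simp
    qed (use assms(2) in auto)
  qed (use finU in \<open>auto simp: card_Diff_subset\<close>)
  then have "card {S. U \<subseteq> S \<and> S \<subseteq> R \<and> card S = r} = card {S. S \<subseteq> R - U \<and> card S = r - card U}"
    by (rule bij_betw_same_card[symmetric])
  then show ?thesis
    using assms finU by (simp add: n_subsets card_Diff_subset)
qed

lemma card_sparse_columns_superset:
  assumes "finite R" "0 < r" "U \<subseteq> R" "card U \<le> r"
  shows "card {v \<in> sparse_columns R r. U \<subseteq> supp v}
    = ((card R - card U) choose (r - card U)) * 2 ^ r"
proof -
  define \<S> where "\<S> = {S. U \<subseteq> S \<and> S \<subseteq> R \<and> card S = r}"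
  define C where "C S = PiE_dflt S 0 (\<lambda>_. {- (1 / sqrt r), 1 / sqrt r})" for S :: "'a set"
  have C_iff: "v \<in> C S \<longleftrightarrow> v \<in> sparse_columns R r \<and> supp v = S" if "S \<in> \<S>" for v S
    using sparse_columns_iff_PiE_dflt[of S R r v] that assms(2) by (simp add: \<S>_def C_def)
  have fin: "finite \<S>" "\<And>S. S \<in> \<S> \<Longrightarrow> finite S"
    using assms(1) by (auto simp: \<S>_def intro: finite_subset)
  have "1 / sqrt r \<noteq> - (1 / sqrt r)" using assms(2) by simp
  then have card_C: "card (C S) = 2 ^ r" if "S \<in> \<S>" for S
    using that fin(2)[OF that] by (simp add: C_def card_PiE_dflt \<S>_def numeral_2_eq_2)
  have "{v \<in> sparse_columns R r. U \<subseteq> supp v} = (\<Union>S\<in>\<S>. C S)"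
    using C_iff by (auto simp: \<S>_def sparse_columns_def)
  also have "card \<dots> = (\<Sum>S\<in>\<S>. card (C S))"
    using fin C_iff by (intro card_UN_disjoint) (auto simp: C_def intro!: finite_PiE_dflt)
  also have "\<dots> = card \<S> * 2 ^ r"
    using card_C by simp
  also have "card \<S> = (card R - card U) choose (r - card U)"
    unfolding \<S>_def using assms by (intro card_subsets_between)
  finally show ?thesis .
qed

lemma power_mult_binomial_le:
  assumes "k \<le> r" "r \<le> d"
  shows "real d ^ k * real (r choose k) \<le> real r ^ k * real (d choose k)"
proof -
  have "real d ^ k * real (r choose k) = (\<Prod>i = 0..<k. real d * (real (r - i) / real (k - i)))"
    using assms by (simp add: binomial_altdef_of_nat prod.distrib del: times_divide_eq_right)
  also have "\<dots> \<le> (\<Prod>i = 0..<k. real r * (real (d - i) / real (k - i)))"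
  proof (intro prod_mono conjI)
    fix i assume "i \<in> {0..<k}"
    then have "real d * real (r - i) \<le> real r * real (d - i)"
      using assms mult_right_mono[of "real r" "real d" "real i"]
      by (simp add: of_nat_diff algebra_simps)
    then show "real d * (real (r - i) / real (k - i)) \<le> real r * (real (d - i) / real (k - i))"
      by (simp add: divide_right_mono)
  qed simp
  also have "\<dots> = real r ^ k * real (d choose k)"
    using assms by (simp add: binomial_altdef_of_nat prod.distrib del: times_divide_eq_right)
  finally show ?thesis .
qed

lemma power_mult_binomial_diff_le:
  assumes "k \<le> r" "r \<le> d"
  shows "real d ^ k * real ((d - k) choose (r - k)) \<le> real r ^ k * real (d choose r)"
proof -
  have "real (d choose k) * (real d ^ k * real ((d - k) choose (r - k)))
      = real (d choose r) * (real d ^ k * real (r choose k))"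
    using choose_mult[OF assms] by (simp flip: of_nat_mult add: mult_ac)
  also have "\<dots> \<le> real (d choose r) * (real r ^ k * real (d choose k))"
    by (intro mult_left_mono power_mult_binomial_le assms) simp
  finally show ?thesis
    using assms by (simp add: mult_ac)
qed

lemma sparse_columns_card_subset_le:
  assumes "finite R" "v \<in> sparse_columns R r" "U \<subseteq> supp v"
  shows "card U \<le> r"
proof -
  have "finite (supp v)"
    using assms(1,2) by (auto simp: sparse_columns_def intro: finite_subset)
  then have "card U \<le> card (supp v)" using assms(3) by (rule card_mono)
  then show ?thesis using assms(2) by (simp add: sparse_columns_def)
qed

lemma prob_sparse_columns_superset:
  assumes "finite R" "0 < r" "r \<le> card R" "U \<subseteq> R"
  shows "measure_pmf.prob (pmf_of_set (sparse_columns R r)) {v. U \<subseteq> supp v}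
    \<le> (r / card R) ^ card U"
proof -
  let ?d = "card R" and ?k = "card U"
  have "sparse_columns R r \<noteq> {}" "finite (sparse_columns R r)"
    using assms by (simp_all add: sparse_columns_nonempty finite_sparse_columns)
  then have prob: "measure_pmf.prob (pmf_of_set (sparse_columns R r)) {v. U \<subseteq> supp v}
      = card {v \<in> sparse_columns R r. U \<subseteq> supp v} / card (sparse_columns R r)"
    by (simp add: measure_pmf_of_set Int_def)
  show ?thesis
  proof (cases "?k \<le> r")
    case True
    have "card (sparse_columns R r) = (?d choose r) * 2 ^ r"
      using card_sparse_columns_superset[of R r "{}"] assms by simp
    then have "measure_pmf.prob (pmf_of_set (sparse_columns R r)) {v. U \<subseteq> supp v}
        = ((?d - ?k) choose (r - ?k)) / (?d choose r)"
      using True assms by (simp add: prob card_sparse_columns_superset)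
    also have "\<dots> \<le> (r / ?d) ^ ?k"
      using power_mult_binomial_diff_le[OF True assms(3)] assms
      by (simp add: power_divide field_simps)
    finally show ?thesis .
  next
    case False
    then have "{v \<in> sparse_columns R r. U \<subseteq> supp v} = {}"
      using sparse_columns_card_subset_le[OF assms(1)] by blast
    then show ?thesis by (simp only: prob) simp
  qed
qed

lemma sum_Pow_power_card:
  fixes x :: "'b::comm_semiring_1"
  assumes "finite A"
  shows "(\<Sum>U\<in>Pow A. x ^ card U) = (1 + x) ^ card A"
  using prod_add[OF assms, of "\<lambda>_. x" "\<lambda>_. 1"] by (simp add: add.commute)

lemma expectation_exp_card_Int_le:
  fixes S :: "'a \<Rightarrow> 'b set" and \<theta> :: real
  assumes "finite (set_pmf p)" "finite T" "0 \<le> \<theta>"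
    and superset: "\<And>U. U \<subseteq> T \<Longrightarrow> measure_pmf.prob p {x. U \<subseteq> S x} \<le> q ^ card U"
  shows "measure_pmf.expectation p (\<lambda>x. exp (\<theta> * card (T \<inter> S x)))
    \<le> (1 + q * (exp \<theta> - 1)) ^ card T"
proof -
  define e where "e = exp \<theta> - 1"
  have "0 \<le> e" using assms(3) by (simp add: e_def)
  have expand: "exp (\<theta> * card (T \<inter> S x)) = (\<Sum>U\<in>Pow T. e ^ card U * indicator {x. U \<subseteq> S x} x)" for x
  proof -
    have "exp (\<theta> * card (T \<inter> S x)) = (1 + e) ^ card (T \<inter> S x)"
      by (simp add: e_def exp_of_nat2_mult)
    also have "\<dots> = (\<Sum>U\<in>Pow (T \<inter> S x). e ^ card U)"
      using assms(2) by (intro sum_Pow_power_card[symmetric]) simp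
    also have "\<dots> = (\<Sum>U\<in>Pow T. if U \<subseteq> S x then e ^ card U else 0)"
      using assms(2) by (intro sum.mono_neutral_cong_left) auto
    also have "\<dots> = (\<Sum>U\<in>Pow T. e ^ card U * indicator {x. U \<subseteq> S x} x)"
      by (intro sum.cong) auto
    finally show ?thesis .
  qed
  have "measure_pmf.expectation p (\<lambda>x. exp (\<theta> * card (T \<inter> S x)))
      = (\<Sum>U\<in>Pow T. e ^ card U * measure_pmf.prob p {x. U \<subseteq> S x})"
    unfolding expand using assms(1)
    by (subst Bochner_Integration.integral_sum) (auto intro: integrable_measure_pmf_finite)
  also have "\<dots> \<le> (\<Sum>U\<in>Pow T. e ^ card U * q ^ card U)"
    using superset \<open>0 \<le> e\<close> by (intro sum_mono mult_left_mono) auto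
  also have "\<dots> = (1 + q * e) ^ card T"
    using sum_Pow_power_card[OF assms(2), of "q * e"] by (simp add: power_mult_distrib mult_ac)
  finally show ?thesis by (simp add: e_def)
qed

lemma sparse_columns_overlap_mgf:
  assumes "finite R" "0 < r" "r \<le> card R" "w \<in> sparse_columns R r" "0 \<le> \<theta>" "\<theta> \<le> (real r)\<^sup>2"
  shows "measure_pmf.expectation (pmf_of_set (sparse_columns R r))
      (\<lambda>v. exp (\<theta> * (\<Sum>l\<in>R. (v l)\<^sup>2 * (w l)\<^sup>2))) \<le> exp (2 * \<theta> / card R)"
proof -
  let ?C = "pmf_of_set (sparse_columns R r)"
  define \<eta> where "\<eta> = \<theta> / (real r)\<^sup>2"
  have \<eta>: "0 \<le> \<eta>" "\<eta> \<le> 1" using assms by (auto simp: \<eta>_def)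
  have set_C: "set_pmf ?C = sparse_columns R r" "finite (set_pmf ?C)"
    using assms by (simp_all add: finite_sparse_columns sparse_columns_nonempty)
  have supp_w: "supp w \<subseteq> R" "card (supp w) = r" "finite (supp w)"
    using assms by (auto simp: sparse_columns_def intro: finite_subset)
  have "measure_pmf.expectation ?C (\<lambda>v. exp (\<theta> * (\<Sum>l\<in>R. (v l)\<^sup>2 * (w l)\<^sup>2)))
      = measure_pmf.expectation ?C (\<lambda>v. exp (\<eta> * card (supp w \<inter> supp v)))"
  proof (rule integral_cong_AE; (rule AE_pmfI)?)
    fix v assume "v \<in> set_pmf ?C"
    then show "exp (\<theta> * (\<Sum>l\<in>R. (v l)\<^sup>2 * (w l)\<^sup>2)) = exp (\<eta> * card (supp w \<inter> supp v))"
      using assms(1,4) set_C by (simp add: sparse_columns_sum_power2_mult \<eta>_def)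
  qed auto
  also have "\<dots> \<le> (1 + r / card R * (exp \<eta> - 1)) ^ r"
    using expectation_exp_card_Int_le[OF set_C(2) supp_w(3) \<eta>(1), of supp "r / card R"]
      prob_sparse_columns_superset[OF assms(1-3)] supp_w by force
  also have "\<dots> \<le> (1 + r / card R * (2 * \<eta>)) ^ r"
  proof (intro power_mono add_left_mono mult_left_mono)
    have "exp \<eta> \<le> 1 + \<eta> + \<eta>\<^sup>2" using \<eta> by (intro exp_bound)
    moreover have "\<eta>\<^sup>2 \<le> \<eta>" using \<eta> by (simp add: power2_eq_square mult_left_le)
    ultimately show "exp \<eta> - 1 \<le> 2 * \<eta>" by simp
  qed (use \<eta> in auto)
  also have "\<dots> \<le> exp (r / card R * (2 * \<eta>)) ^ r"
    using \<eta> by (intro power_mono exp_ge_add_one_self) auto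
  also have "\<dots> = exp (2 * \<theta> / card R)"
    using assms(2) by (simp add: \<eta>_def power2_eq_square flip: exp_of_nat_mult)
  finally show ?thesis .
qed

locale random_sparse_columns =
  fixes J :: "'a set" and R :: "'b set" and r :: nat
  assumes finite_J: "finite J" and finite_R: "finite R"
    and r_pos: "0 < r" and r_le: "r \<le> card R"
begin

definition families :: "('a \<Rightarrow> 'b \<Rightarrow> real) set" where
  "families = PiE_dflt J (\<lambda>_. 0) (\<lambda>_. sparse_columns R r)"

definition random_family :: "('a \<Rightarrow> 'b \<Rightarrow> real) pmf" where
  "random_family = Pi_pmf J (\<lambda>_. 0) (\<lambda>_. pmf_of_set (sparse_columns R r))"

lemma set_pmf_of_set_columns: "set_pmf (pmf_of_set (sparse_columns R r)) = sparse_columns R r"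
  and finite_columns: "finite (sparse_columns R r)"
  using finite_R r_pos r_le by (simp_all add: finite_sparse_columns sparse_columns_nonempty)

lemma finite_families: "finite families"
  unfolding families_def using finite_J finite_columns by (intro finite_PiE_dflt)

lemma families_nonempty: "families \<noteq> {}"
  using r_pos r_le by (simp add: families_def sparse_columns_nonempty)

lemma random_family_eq_pmf_of_set: "random_family = pmf_of_set families"
  unfolding random_family_def families_def
  using finite_J finite_columns r_pos r_le
  by (intro Pi_pmf_of_set) (simp_all add: sparse_columns_nonempty)

lemma set_random_family: "set_pmf random_family = families"
  using finite_families families_nonempty by (simp add: random_family_eq_pmf_of_set)

lemma families_column: "c \<in> families \<Longrightarrow> j \<in> J \<Longrightarrow> c j \<in> sparse_columns R r"
  by (simp add: families_def PiE_dflt_def)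

lemma random_family_sign_flip:
  assumes "\<And>l j. \<bar>\<sigma> l j\<bar> = 1"
  shows "map_pmf (\<lambda>c j l. \<sigma> l j * c j l) random_family = random_family"
  unfolding random_family_eq_pmf_of_set
proof (rule map_pmf_of_set_involution[OF finite_families families_nonempty])
  have "\<sigma> l j * \<sigma> l j = 1" for l j
    using assms[of l j] by (auto simp: abs_if split: if_splits)
  then show "(\<lambda>j l. \<sigma> l j * (\<sigma> l j * c j l)) = c" for c
    by (simp flip: mult.assoc)
  show "(\<lambda>j l. \<sigma> l j * c j l) \<in> families" if "c \<in> families" for c
    using that assms by (auto simp: families_def PiE_dflt_def intro: sparse_columns_sign_flip)
qed

lemma random_family_overlap_mgf:
  assumes "i \<in> J" "j \<in> J" "i \<noteq> j" "0 \<le> \<theta>" "\<theta> \<le> (real r)\<^sup>2"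
  shows "measure_pmf.expectation random_family
      (\<lambda>c. exp (\<theta> * (\<Sum>l\<in>R. (c i l)\<^sup>2 * (c j l)\<^sup>2))) \<le> exp (2 * \<theta> / card R)"
  unfolding random_family_def
proof (rule expectation_Pi_pmf_le_conditional[OF finite_J assms(1)])
  fix c assume "c \<in> set_pmf (Pi_pmf (J - {i}) (\<lambda>_. 0) (\<lambda>_. pmf_of_set (sparse_columns R r)))"
  then have "c j \<in> sparse_columns R r"
    using finite_J assms(2,3) by (simp add: set_Pi_pmf PiE_dflt_def set_pmf_of_set_columns)
  then show "measure_pmf.expectation (pmf_of_set (sparse_columns R r))
      (\<lambda>v. exp (\<theta> * (\<Sum>l\<in>R. ((c(i := v)) i l)\<^sup>2 * ((c(i := v)) j l)\<^sup>2))) \<le> exp (2 * \<theta> / card R)"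
    using sparse_columns_overlap_mgf[OF finite_R r_pos r_le] assms by simp
qed (simp add: set_pmf_of_set_columns finite_columns)

lemma sum_cross_sum_eq_norm_deviation:
  assumes "c \<in> families"
  shows "(\<Sum>l\<in>R. cross_sum J (\<lambda>j. c j l * u j)) = (\<Sum>l\<in>R. (\<Sum>j\<in>J. c j l * u j)\<^sup>2) - (\<Sum>j\<in>J. (u j)\<^sup>2)"
proof -
  have "(\<Sum>l\<in>R. \<Sum>j\<in>J. (c j l * u j)\<^sup>2) = (\<Sum>j\<in>J. (\<Sum>l\<in>R. (c j l)\<^sup>2) * (u j)\<^sup>2)"
    by (subst sum.swap) (simp add: power_mult_distrib sum_distrib_right)
  also have "\<dots> = (\<Sum>j\<in>J. (u j)\<^sup>2)"
    by (intro sum.cong refl)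
      (simp add: sparse_columns_sum_power2[OF finite_R r_pos families_column[OF assms]])
  finally show ?thesis
    using finite_J by (simp add: cross_sum_eq sum_subtractf)
qed

lemma families_row_power2_le:
  assumes "c \<in> families"
  shows "(\<Sum>j\<in>J. (c j l * u j)\<^sup>2) \<le> (\<Sum>j\<in>J. (u j)\<^sup>2) / r"
  unfolding sum_divide_distrib power_mult_distrib
  by (intro sum_mono) (simp add: sparse_columns_power2[OF families_column[OF assms]])

lemma expectation_sign_matrix_family_le:
  fixes u :: "'a \<Rightarrow> real"
  assumes "c \<in> families" "4 * \<bar>\<nu>\<bar> * (\<Sum>j\<in>J. (u j)\<^sup>2) \<le> r"
  shows "measure_pmf.expectation (sign_matrix J R)
      (\<lambda>\<sigma>. exp (\<nu> * (\<Sum>l\<in>R. cross_sum J (\<lambda>j. \<sigma> l j * c j l * u j))))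
    \<le> exp (4 * \<nu>\<^sup>2 * (\<Sum>l\<in>R. cross_sum J (\<lambda>j. (c j l * u j)\<^sup>2)))"
proof -
  have "\<bar>\<nu>\<bar> \<le> 2 * \<bar>\<nu>\<bar> * (1 - 2 * \<bar>\<nu>\<bar> * (\<Sum>j\<in>J. (c j l * u j)\<^sup>2))" for l
  proof -
    have "4 * \<bar>\<nu>\<bar> * (\<Sum>j\<in>J. (c j l * u j)\<^sup>2) \<le> 4 * \<bar>\<nu>\<bar> * ((\<Sum>j\<in>J. (u j)\<^sup>2) / r)"
      using families_row_power2_le[OF assms(1)] by (intro mult_left_mono) auto
    also have "\<dots> \<le> 1"
      using assms(2) r_pos by (simp add: field_simps)
    finally have "\<bar>\<nu>\<bar> * 1 \<le> \<bar>\<nu>\<bar> * (2 - 4 * \<bar>\<nu>\<bar> * (\<Sum>j\<in>J. (c j l * u j)\<^sup>2))"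
      by (intro mult_left_mono) auto
    then show ?thesis by (simp add: algebra_simps)
  qed
  then show ?thesis
    using sign_matrix_chaos_mgf[OF finite_J finite_R, of "2 * \<bar>\<nu>\<bar>" \<nu> "\<lambda>l j. c j l * u j"]
    by (simp add: power_mult_distrib mult.assoc)
qed

lemma sum_cross_sum_power2:
  "(\<Sum>l\<in>R. cross_sum J (\<lambda>j. (c j l * u j)\<^sup>2)) =
    (\<Sum>(i, j)\<in>Sigma J (\<lambda>i. J - {i}). (u i)\<^sup>2 * (u j)\<^sup>2 * (\<Sum>l\<in>R. (c i l)\<^sup>2 * (c j l)\<^sup>2))"
  unfolding cross_sum_def
  by (subst sum.swap) (auto intro!: sum.cong simp: power_mult_distrib sum_distrib_left mult_ac)

lemma random_family_cross_sum_power2_mgf: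
  fixes u :: "'a \<Rightarrow> real"
  defines "N \<equiv> \<Sum>j\<in>J. (u j)\<^sup>2"
  assumes "0 < N" "0 \<le> \<theta>" "\<theta> * N\<^sup>2 \<le> (real r)\<^sup>2"
  shows "measure_pmf.expectation random_family
      (\<lambda>c. exp (\<theta> * (\<Sum>l\<in>R. cross_sum J (\<lambda>j. (c j l * u j)\<^sup>2)))) \<le> exp (2 * (\<theta> * N\<^sup>2) / card R)"
proof -
  let ?I = "Sigma J (\<lambda>i. J - {i})"
  define w where "w = (\<lambda>(i, j). (u i)\<^sup>2 * (u j)\<^sup>2 / N\<^sup>2)"
  define overlap where "overlap c = (\<lambda>(i, j). \<Sum>l\<in>R. (c i l)\<^sup>2 * (c j l)\<^sup>2)"
    for c :: "'a \<Rightarrow> 'b \<Rightarrow> real"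
  have "\<theta> * (\<Sum>l\<in>R. cross_sum J (\<lambda>j. (c j l * u j)\<^sup>2)) = (\<Sum>p\<in>?I. w p * (\<theta> * N\<^sup>2 * overlap c p))"
    for c
    unfolding sum_cross_sum_power2 sum_distrib_left[of _ _ ?I] using \<open>0 < N\<close>
    by (intro sum.cong refl) (auto simp: w_def overlap_def)
  moreover have "measure_pmf.expectation random_family
      (\<lambda>c. exp (\<Sum>p\<in>?I. w p * (\<theta> * N\<^sup>2 * overlap c p))) \<le> exp (2 * (\<theta> * N\<^sup>2) / card R)"
  proof (rule expectation_exp_weighted_sum_le)
    have "sum w ?I = cross_sum J (\<lambda>j. (u j)\<^sup>2) / N\<^sup>2"
      by (simp add: cross_sum_def w_def sum_divide_distrib case_prod_unfold)
    also have "\<dots> \<le> 1"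
      using \<open>0 < N\<close> finite_J by (simp add: cross_sum_eq N_def sum_nonneg)
    finally show "sum w ?I \<le> 1" .
    fix p assume "p \<in> ?I"
    then obtain i j where "p = (i, j)" "i \<in> J" "j \<in> J" "i \<noteq> j" by auto
    then show "measure_pmf.expectation random_family (\<lambda>c. exp (\<theta> * N\<^sup>2 * overlap c p))
        \<le> exp (2 * (\<theta> * N\<^sup>2) / card R)"
      using random_family_overlap_mgf[of i j "\<theta> * N\<^sup>2"] assms(3,4) by (simp add: overlap_def)
  qed (use assms(3) in \<open>auto simp: w_def set_random_family finite_families\<close>)
  ultimately show ?thesis by simp
qed

lemma random_family_mgf:
  fixes u :: "'a \<Rightarrow> real"
  defines "N \<equiv> \<Sum>j\<in>J. (u j)\<^sup>2"
  assumes "0 < N" "4 * \<bar>\<nu>\<bar> * N \<le> r"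
  shows "measure_pmf.expectation random_family
      (\<lambda>c. exp (\<nu> * ((\<Sum>l\<in>R. (\<Sum>j\<in>J. c j l * u j)\<^sup>2) - N))) \<le> exp (8 * (\<nu> * N)\<^sup>2 / card R)"
proof -
  define F where "F c = exp (\<nu> * (\<Sum>l\<in>R. cross_sum J (\<lambda>j. c j l * u j)))" for c
  have fin: "finite (set_pmf random_family)" "finite (set_pmf (sign_matrix J R))"
    by (simp_all add: set_random_family finite_families finite_set_sign_matrix finite_J finite_R)
  have "measure_pmf.expectation random_family
      (\<lambda>c. exp (\<nu> * ((\<Sum>l\<in>R. (\<Sum>j\<in>J. c j l * u j)\<^sup>2) - N)))
    = measure_pmf.expectation random_family F"
    unfolding F_def N_def
    by (rule integral_cong_AE; (rule AE_pmfI)?)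
      (simp_all add: sum_cross_sum_eq_norm_deviation set_random_family)
  also have "\<dots> = measure_pmf.expectation random_family (\<lambda>c.
      measure_pmf.expectation (sign_matrix J R) (\<lambda>\<sigma>. F (\<lambda>j l. \<sigma> l j * c j l)))"
    using fin abs_sign_matrix[OF finite_J finite_R]
    by (intro expectation_symmetrise_pmf_finite random_family_sign_flip) auto
  also have "\<dots> \<le> measure_pmf.expectation random_family
      (\<lambda>c. exp (4 * \<nu>\<^sup>2 * (\<Sum>l\<in>R. cross_sum J (\<lambda>j. (c j l * u j)\<^sup>2))))"
    using assms unfolding F_def
    by (intro expectation_mono_pmf_finite fin expectation_sign_matrix_family_le)
      (simp_all add: set_random_family)
  also have "\<dots> \<le> exp (2 * (4 * \<nu>\<^sup>2 * N\<^sup>2) / card R)"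
    unfolding N_def
  proof (rule random_family_cross_sum_power2_mgf)
    have "4 * \<nu>\<^sup>2 * N\<^sup>2 \<le> (4 * \<bar>\<nu>\<bar> * N)\<^sup>2" by (simp add: power_mult_distrib)
    also have "\<dots> \<le> (real r)\<^sup>2" using assms(2,3) by (intro power_mono) auto
    finally show "4 * \<nu>\<^sup>2 * (\<Sum>j\<in>J. (u j)\<^sup>2)\<^sup>2 \<le> (real r)\<^sup>2" by (simp add: N_def)
  qed (use assms(2) in \<open>simp_all add: N_def\<close>)
  finally show ?thesis by (simp add: power_mult_distrib mult.assoc)
qed

lemma random_family_tail:
  fixes u :: "'a \<Rightarrow> real"
  defines "N \<equiv> \<Sum>j\<in>J. (u j)\<^sup>2"
  assumes "0 < \<epsilon>" "0 < L" "32 * L \<le> real (card R) * \<epsilon>\<^sup>2" "8 * L \<le> real r * \<epsilon>"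
  shows "measure_pmf.prob random_family
      {c. \<epsilon> * N < \<bar>(\<Sum>l\<in>R. (\<Sum>j\<in>J. c j l * u j)\<^sup>2) - N\<bar>} \<le> 2 * exp (- L)"
proof (cases "N = 0")
  case True
  then have "\<forall>j\<in>J. u j = 0"
    unfolding N_def using finite_J by (simp add: sum_nonneg_eq_0_iff)
  then show ?thesis by (simp add: N_def)
next
  case False
  then have "0 < N" by (simp add: N_def sum_nonneg less_le)
  define \<nu> where "\<nu> = 2 * L / (\<epsilon> * N)"
  have \<nu>: "0 < \<nu>" "\<nu> * N = 2 * L / \<epsilon>" "4 * \<bar>\<nu>\<bar> * N \<le> r"
    using assms \<open>0 < N\<close> by (auto simp: \<nu>_def field_simps)
  have "8 * (\<nu> * N)\<^sup>2 / card R = 32 * L * (L / (card R * \<epsilon>\<^sup>2))"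
    unfolding \<nu>(2) by (simp add: power2_eq_square mult_ac)
  also have "\<dots> \<le> L"
    using assms r_pos r_le mult_right_mono[OF assms(4), of L] by (simp add: field_simps)
  finally have exponent: "8 * (\<nu> * N)\<^sup>2 / card R \<le> L" .
  have mgf: "measure_pmf.expectation random_family
      (\<lambda>c. exp (s * ((\<Sum>l\<in>R. (\<Sum>j\<in>J. c j l * u j)\<^sup>2) - N))) \<le> exp L" if "\<bar>s\<bar> = \<nu>" for s
  proof -
    have "(s * N)\<^sup>2 = (\<nu> * N)\<^sup>2"
      using that by (metis power2_abs power_mult_distrib)
    then have "measure_pmf.expectation random_family
        (\<lambda>c. exp (s * ((\<Sum>l\<in>R. (\<Sum>j\<in>J. c j l * u j)\<^sup>2) - N))) \<le> exp (8 * (\<nu> * N)\<^sup>2 / card R)"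
      using random_family_mgf[of u s, folded N_def] \<open>0 < N\<close> \<nu> that by simp
    also have "\<dots> \<le> exp L" using exponent by simp
    finally show ?thesis .
  qed
  have "measure_pmf.prob random_family
      {c. \<epsilon> * N < \<bar>(\<Sum>l\<in>R. (\<Sum>j\<in>J. c j l * u j)\<^sup>2) - N\<bar>} \<le> 2 * (exp (- \<nu> * (\<epsilon> * N)) * exp L)"
    using \<nu>(1) by (intro Chernoff_two_sided_pmf_finite mgf)
      (simp_all add: set_random_family finite_families)
  also have "\<dots> = 2 * exp (- L)"
    using \<nu>(2) assms(2) by (simp add: field_simps flip: exp_add)
  finally show ?thesis .
qed

end

section \<open>Sparse Johnson--Lindenstrauss matrices\<close>

definition mat_column :: "real mat \<Rightarrow> nat \<Rightarrow> nat \<Rightarrow> real" where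
  "mat_column A j i = (if i < dim_row A \<and> j < dim_col A then A $$ (i, j) else 0)"

lemma sjl_matrices_carrier: "sjl_matrices d r \<subseteq> carrier_mat d d"
  by (auto simp: sjl_matrices_def)

lemma sjl_matrices_iff_mat_column:
  assumes "A \<in> carrier_mat d d" "0 < r"
  shows "A \<in> sjl_matrices d r \<longleftrightarrow> (\<forall>j<d. mat_column A j \<in> sparse_columns {..<d} r)"
proof -
  have supp: "supp (mat_column A j) = {i. i < d \<and> A $$ (i, j) \<noteq> 0}" if "j < d" for j
    using assms(1) that by (auto simp: supp_def mat_column_def)
  have entry: "a \<in> {- (1 / sqrt r), 0, 1 / sqrt r} \<longleftrightarrow> (a \<noteq> 0 \<longrightarrow> \<bar>a\<bar> = 1 / sqrt r)" for a
    using assms(2) by (auto simp: abs_if)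
  have index: "mat_column A j i = A $$ (i, j)" if "i < d" "j < d" for i j
    using assms(1) that by (simp add: mat_column_def)
  have "mat_column A j \<in> sparse_columns {..<d} r \<longleftrightarrow>
      card {i. i < d \<and> A $$ (i, j) \<noteq> 0} = r \<and> (\<forall>i<d. A $$ (i, j) \<in> {- (1 / sqrt r), 0, 1 / sqrt r})"
    if "j < d" for j
    unfolding sparse_columns_def mem_Collect_eq supp[OF that] entry
    using that by (auto simp: index)
  then show ?thesis
    using assms(1) unfolding sjl_matrices_def by blast
qed

text \<open>Column \<open>j\<close> of $A_0$ has the index \<open>(False, j)\<close>, column \<open>j\<close> of $A_1$ the index \<open>(True, j)\<close>.\<close>

definition mat_pair_of_columns :: "nat \<Rightarrow> (bool \<times> nat \<Rightarrow> nat \<Rightarrow> real) \<Rightarrow> real mat \<times> real mat" where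
  "mat_pair_of_columns d c =
     (mat d d (\<lambda>(i, j). c (False, j) i), mat d d (\<lambda>(i, j). c (True, j) i))"

definition columns_of_mat_pair :: "real mat \<times> real mat \<Rightarrow> bool \<times> nat \<Rightarrow> nat \<Rightarrow> real" where
  "columns_of_mat_pair A = (\<lambda>(b, j). mat_column (if b then snd A else fst A) j)"

lemma mat_column_mat:
  assumes "j < d" "supp (c j) \<subseteq> {..<d}"
  shows "mat_column (mat d d (\<lambda>(i, j). c j i)) j = c j"
  using assms by (force simp: mat_column_def supp_def)

lemma mat_mat_column:
  assumes "A \<in> carrier_mat d d"
  shows "mat d d (\<lambda>(i, j). mat_column A j i) = A"
  using assms by (intro eq_matI) (auto simp: mat_column_def)

locale sjl_params =
  fixes d r :: nat
  assumes r_pos: "0 < r" and r_le: "r \<le> d"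
begin

sublocale columns: random_sparse_columns "UNIV \<times> {..<d} :: (bool \<times> nat) set" "{..<d}" r
  using r_pos r_le by unfold_locales auto

lemma columns_families_column:
  assumes "c \<in> columns.families" "j < d"
  shows "c (b, j) \<in> sparse_columns {..<d} r" "supp (c (b, j)) \<subseteq> {..<d}"
  using columns.families_column[OF assms(1), of "(b, j)"] assms(2)
  by (auto simp: sparse_columns_def)

lemma columns_of_mat_pair_of_columns:
  assumes "c \<in> columns.families"
  shows "columns_of_mat_pair (mat_pair_of_columns d c) = c"
proof (intro ext)
  fix p :: "bool \<times> nat" and i
  obtain b j where p: "p = (b, j)" by (cases p)
  show "columns_of_mat_pair (mat_pair_of_columns d c) p i = c p i"
  proof (cases "j < d")
    case True
    then show ?thesis
      using columns_families_column(2)[OF assms True, of b] mat_column_mat[of j d "\<lambda>j. c (b, j)"]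
      by (cases b) (simp_all add: p columns_of_mat_pair_def mat_pair_of_columns_def)
  next
    case False
    then show ?thesis
      using assms by (simp add: p columns_of_mat_pair_def mat_pair_of_columns_def mat_column_def
          columns.families_def PiE_dflt_def)
  qed
qed

lemma columns_of_mat_pair_in_families:
  assumes "A \<in> sjl_matrices d r" "B \<in> sjl_matrices d r"
  shows "columns_of_mat_pair (A, B) \<in> columns.families"
proof -
  have carrier: "A \<in> carrier_mat d d" "B \<in> carrier_mat d d"
    using assms sjl_matrices_carrier by auto
  then have "mat_column A j \<in> sparse_columns {..<d} r" "mat_column B j \<in> sparse_columns {..<d} r"
    if "j < d" for j
    using assms that r_pos sjl_matrices_iff_mat_column by auto
  moreover have "mat_column A j = (\<lambda>_. 0)" "mat_column B j = (\<lambda>_. 0)" if "\<not> j < d" for j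
    using carrier that by (auto simp: mat_column_def)
  ultimately show ?thesis
    by (auto simp: columns_of_mat_pair_def columns.families_def PiE_dflt_def)
qed

lemma bij_betw_mat_pair_of_columns:
  "bij_betw (mat_pair_of_columns d) columns.families (sjl_matrices d r \<times> sjl_matrices d r)"
proof (rule bij_betw_byWitness[where f' = columns_of_mat_pair])
  show "\<forall>A\<in>sjl_matrices d r \<times> sjl_matrices d r. mat_pair_of_columns d (columns_of_mat_pair A) = A"
  proof safe
    fix A B assume "A \<in> sjl_matrices d r" "B \<in> sjl_matrices d r"
    then have "A \<in> carrier_mat d d" "B \<in> carrier_mat d d"
      using sjl_matrices_carrier by auto
    then show "mat_pair_of_columns d (columns_of_mat_pair (A, B)) = (A, B)"
      by (simp add: mat_pair_of_columns_def columns_of_mat_pair_def mat_mat_column)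
  qed
  show "mat_pair_of_columns d ` columns.families \<subseteq> sjl_matrices d r \<times> sjl_matrices d r"
    by (intro image_subsetI) (simp add: mat_pair_of_columns_def sjl_matrices_iff_mat_column
        mat_column_mat columns_families_column r_pos)
qed (auto simp: columns_of_mat_pair_of_columns columns_of_mat_pair_in_families)

lemma finite_sjl_matrices: "finite (sjl_matrices d r)"
  and sjl_matrices_nonempty: "sjl_matrices d r \<noteq> {}"
proof -
  have "finite (sjl_matrices d r \<times> sjl_matrices d r)" "sjl_matrices d r \<times> sjl_matrices d r \<noteq> {}"
    using columns.finite_families columns.families_nonempty bij_betw_mat_pair_of_columns
    by (auto simp: bij_betw_def simp flip: finite_image_iff)
  then show "finite (sjl_matrices d r)" "sjl_matrices d r \<noteq> {}"
    by (auto simp: finite_cartesian_product_iff)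
qed

lemma set_sjl_dist: "set_pmf (sjl_dist d r) = sjl_matrices d r \<times> sjl_matrices d r"
  using finite_sjl_matrices sjl_matrices_nonempty by (simp add: sjl_dist_def)

lemma set_sketch_maps:
  assumes "\<phi> \<in> set_pmf (sketch_maps k d r)" "l \<in> {1..k}"
  shows "\<phi> l \<in> sjl_matrices d r \<times> sjl_matrices d r"
  using assms by (simp add: sketch_maps_def set_Pi_pmf PiE_dflt_def set_sjl_dist)

lemma sjl_dist_eq_map_random_family:
  "sjl_dist d r = map_pmf (mat_pair_of_columns d) columns.random_family"
  using finite_sjl_matrices sjl_matrices_nonempty columns.finite_families columns.families_nonempty
    map_pmf_of_set_bij_betw[OF bij_betw_mat_pair_of_columns]
  by (simp add: sjl_dist_def pair_pmf_of_set columns.random_family_eq_pmf_of_set)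

end

lemma vnorm_power2:
  assumes "v \<in> carrier_vec n"
  shows "(vnorm v)\<^sup>2 = (\<Sum>i<n. (v $ i)\<^sup>2)"
proof -
  have "v \<bullet> v = (\<Sum>i<n. (v $ i)\<^sup>2)"
    using assms by (simp add: scalar_prod_def power2_eq_square atLeast0LessThan)
  then show ?thesis
    by (simp add: vnorm_def sum_nonneg)
qed

lemma vnorm_nonneg: "0 \<le> vnorm v"
  using vnorm_power2[of v "dim_vec v"]
  by (simp add: vnorm_def scalar_prod_def sum_nonneg)

definition distorts :: "real \<Rightarrow> real mat \<times> real mat \<Rightarrow> real vec \<Rightarrow> real vec \<Rightarrow> bool" where
  "distorts \<epsilon> A x y \<longleftrightarrow> \<epsilon> * ((vnorm x)\<^sup>2 + (vnorm y)\<^sup>2)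
     < \<bar>(vnorm (app_map A x y))\<^sup>2 - ((vnorm x)\<^sup>2 + (vnorm y)\<^sup>2)\<bar>"

lemma app_map_carrier:
  assumes "A \<in> carrier_mat d d \<times> carrier_mat d d"
  shows "app_map A x y \<in> carrier_vec d"
  using assms by (intro carrier_vecI) (auto simp: app_map_def)

definition jl_distribution ::
    "nat \<Rightarrow> real \<Rightarrow> real \<Rightarrow> (real mat \<times> real mat) pmf \<Rightarrow> bool" where
  "jl_distribution d \<epsilon> \<delta> F \<longleftrightarrow>
     finite (set_pmf F) \<and> set_pmf F \<subseteq> carrier_mat d d \<times> carrier_mat d d \<and>
     (\<forall>x\<in>carrier_vec d. \<forall>y\<in>carrier_vec d. measure_pmf.prob F {A. distorts \<epsilon> A x y} \<le> \<delta>)"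

lemma (in sjl_params) prob_sjl_dist_distorts:
  assumes "x \<in> carrier_vec d" "y \<in> carrier_vec d"
    and "0 < \<epsilon>" "0 < L" "32 * L \<le> real d * \<epsilon>\<^sup>2" "8 * L \<le> real r * \<epsilon>"
  shows "measure_pmf.prob (sjl_dist d r) {A. distorts \<epsilon> A x y} \<le> 2 * exp (- L)"
proof -
  define u where "u = (\<lambda>(b, j). if b then y $ j else x $ j)"
  have sum_pair: "(\<Sum>p\<in>UNIV \<times> {..<d}. f p) = (\<Sum>j<d. f (False, j)) + (\<Sum>j<d. f (True, j))"
    for f :: "bool \<times> nat \<Rightarrow> real"
    by (simp add: sum.cartesian_product' UNIV_bool)
  have norm_xy: "(vnorm x)\<^sup>2 + (vnorm y)\<^sup>2 = (\<Sum>p\<in>UNIV \<times> {..<d}. (u p)\<^sup>2)"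
    by (simp add: sum_pair u_def vnorm_power2[OF assms(1)] vnorm_power2[OF assms(2)])
  have norm_app: "(vnorm (app_map (mat_pair_of_columns d c) x y))\<^sup>2
      = (\<Sum>l<d. (\<Sum>p\<in>UNIV \<times> {..<d}. c p l * u p)\<^sup>2)" for c
  proof -
    have "app_map (mat_pair_of_columns d c) x y \<in> carrier_vec d"
      by (intro app_map_carrier) (simp add: mat_pair_of_columns_def)
    moreover have "app_map (mat_pair_of_columns d c) x y $ l = (\<Sum>p\<in>UNIV \<times> {..<d}. c p l * u p)"
      if "l < d" for l
      using that assms(1,2) by (simp add: sum_pair u_def app_map_def mat_pair_of_columns_def
          scalar_prod_def atLeast0LessThan)
    ultimately show ?thesis by (simp add: vnorm_power2)
  qed
  show ?thesis
    using columns.random_family_tail[of \<epsilon> L u] assms(3-6)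
    unfolding sjl_dist_eq_map_random_family measure_map_pmf distorts_def norm_xy
    by (simp add: vimage_def norm_app)
qed

lemma (in sjl_params) jl_distribution_sjl_dist:
  assumes "0 < \<epsilon>" "0 < L" "32 * L \<le> real d * \<epsilon>\<^sup>2" "8 * L \<le> real r * \<epsilon>"
  shows "jl_distribution d \<epsilon> (2 * exp (- L)) (sjl_dist d r)"
  using prob_sjl_dist_distorts[OF _ _ assms] sjl_matrices_carrier[of d r]
  by (auto simp: jl_distribution_def set_sjl_dist finite_sjl_matrices)

section \<open>Sketches preserve the norm\<close>

lemma block_carrier [simp]: "block d z j \<in> carrier_vec d"
  by (simp add: block_def)

lemma all_sketch_level_carrier:
  assumes "\<And>l. l \<in> {1..i} \<Longrightarrow> \<phi> l \<in> carrier_mat d d \<times> carrier_mat d d"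
  shows "all_sketch_level d \<phi> x i j \<in> carrier_vec d"
  using assms by (cases i) (auto intro!: app_map_carrier)

lemma all_sketch_level_cong:
  assumes "\<And>l. l \<in> {1..i} \<Longrightarrow> \<phi> l = \<phi>' l"
  shows "all_sketch_level d \<phi> x i j = all_sketch_level d \<phi>' x i j"
  using assms by (induction i arbitrary: j) auto

lemma vnorm_window_power2:
  assumes "1 \<le> j"
  shows "(vnorm (window (s * d) d x j))\<^sup>2 = (\<Sum>l=j..<j + s. (vnorm (block d x l))\<^sup>2)"
proof -
  have "(vnorm (window (s * d) d x j))\<^sup>2 = (\<Sum>p<s * d. (x $ ((j - 1) * d + p))\<^sup>2)"
    by (subst vnorm_power2[of _ "s * d"]) (auto simp: window_def)
  also have "\<dots> = (\<Sum>q<s. \<Sum>p=q * d..<q * d + d. (x $ ((j - 1) * d + p))\<^sup>2)"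
    by (rule sum.nat_group[symmetric])
  also have "\<dots> = (\<Sum>q<s. \<Sum>l<d. (x $ ((j - 1) * d + (q * d + l)))\<^sup>2)"
    by (simp add: sum.atLeastLessThan_shift_0[of _ "_ * d"] atLeast0LessThan add_ac)
  also have "\<dots> = (\<Sum>q<s. (vnorm (block d x (j + q)))\<^sup>2)"
    using assms
    by (intro sum.cong refl, subst vnorm_power2[OF block_carrier])
      (auto simp: block_def algebra_simps)
  also have "\<dots> = (\<Sum>l=j..<j + s. (vnorm (block d x l))\<^sup>2)"
    by (simp add: sum.atLeastLessThan_shift_0 atLeast0LessThan)
  finally show ?thesis .
qed

lemma not_distorts_iff:
  "\<not> distorts \<epsilon> A x y \<longleftrightarrow>
    (1 - \<epsilon>) * ((vnorm x)\<^sup>2 + (vnorm y)\<^sup>2) \<le> (vnorm (app_map A x y))\<^sup>2 \<and>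
    (vnorm (app_map A x y))\<^sup>2 \<le> (1 + \<epsilon>) * ((vnorm x)\<^sup>2 + (vnorm y)\<^sup>2)"
  unfolding distorts_def not_less abs_le_iff by (auto simp: algebra_simps)

definition distorted_level ::
    "real \<Rightarrow> nat \<Rightarrow> (nat \<Rightarrow> real mat \<times> real mat) \<Rightarrow> real vec \<Rightarrow> nat \<Rightarrow> nat \<Rightarrow> bool" where
  "distorted_level \<epsilon> d \<phi> x i j \<longleftrightarrow>
     distorts \<epsilon> (\<phi> (Suc i)) (all_sketch_level d \<phi> x i j) (all_sketch_level d \<phi> x i (j + 2 ^ i))"

lemma all_sketch_level_norm_bounds:
  assumes "0 \<le> \<epsilon>" "real i * \<epsilon> \<le> 1"
    and "\<And>i' j'. i' < i \<Longrightarrow> j' \<in> {1..N} \<Longrightarrow> \<not> distorted_level \<epsilon> d \<phi> x i' j'"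
    and "1 \<le> j" "j + 2 ^ i \<le> N + 1"
  shows "(1 - \<epsilon>) ^ i * (vnorm (window (2 ^ i * d) d x j))\<^sup>2 \<le> (vnorm (all_sketch_level d \<phi> x i j))\<^sup>2
    \<and> (vnorm (all_sketch_level d \<phi> x i j))\<^sup>2 \<le> (1 + \<epsilon>) ^ i * (vnorm (window (2 ^ i * d) d x j))\<^sup>2"
  using assms(2-5)
proof (induction i arbitrary: j)
  case 0
  then show ?case using vnorm_window_power2[of j 1 d x] by simp
next
  case (Suc i)
  define S where "S i j = (vnorm (window (2 ^ i * d) d x j))\<^sup>2" for i j
  define a where "a = (vnorm (all_sketch_level d \<phi> x i j))\<^sup>2"
  define b where "b = (vnorm (all_sketch_level d \<phi> x i (j + 2 ^ i)))\<^sup>2"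
  define v where "v = (vnorm (all_sketch_level d \<phi> x (Suc i) j))\<^sup>2"
  have "real i * \<epsilon> + \<epsilon> \<le> 1" using Suc.prems(1) by (simp add: algebra_simps)
  then have \<epsilon>: "real i * \<epsilon> \<le> 1" "\<epsilon> \<le> 1"
    using assms(1) mult_nonneg_nonneg[of "real i" \<epsilon>] by linarith+
  have "S (Suc i) j = S i j + S i (j + 2 ^ i)"
    using Suc.prems(3) unfolding S_def
    by (simp add: vnorm_window_power2 mult_2 sum.atLeastLessThan_concat flip: add.assoc)
  moreover have "(1 - \<epsilon>) ^ i * S i j \<le> a" "a \<le> (1 + \<epsilon>) ^ i * S i j"
    and "(1 - \<epsilon>) ^ i * S i (j + 2 ^ i) \<le> b" "b \<le> (1 + \<epsilon>) ^ i * S i (j + 2 ^ i)"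
    using Suc.IH[of j] Suc.IH[of "j + 2 ^ i"] Suc.prems \<epsilon>(1) by (simp_all add: a_def b_def S_def)
  ultimately have ab: "(1 - \<epsilon>) ^ i * S (Suc i) j \<le> a + b" "a + b \<le> (1 + \<epsilon>) ^ i * S (Suc i) j"
    by (simp_all add: distrib_left)
  have "(1::nat) \<le> 2 ^ Suc i" by simp
  then have "j \<in> {1..N}" using Suc.prems(3,4) unfolding atLeastAtMost_iff by linarith
  then have v: "(1 - \<epsilon>) * (a + b) \<le> v" "v \<le> (1 + \<epsilon>) * (a + b)"
    using Suc.prems(2)[of i j]
    by (simp_all add: distorted_level_def not_distorts_iff a_def b_def v_def)
  have "(1 - \<epsilon>) ^ Suc i * S (Suc i) j \<le> (1 - \<epsilon>) * (a + b)"
    "(1 + \<epsilon>) * (a + b) \<le> (1 + \<epsilon>) ^ Suc i * S (Suc i) j"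
    unfolding power_Suc mult.assoc using ab \<epsilon>(2) assms(1) by (auto intro!: mult_left_mono)
  then show ?case
    using v unfolding S_def v_def by linarith
qed

lemma power2_one_minus_mult_le_power:
  fixes \<epsilon> :: real
  assumes "0 \<le> \<epsilon>" "real k * \<epsilon> \<le> 1"
  shows "(1 - real k * \<epsilon>)\<^sup>2 \<le> (1 - \<epsilon>) ^ k"
proof (cases "k = 0")
  case False
  then have "1 * \<epsilon> \<le> real k * \<epsilon>" using assms(1) by (intro mult_right_mono) auto
  then have "\<epsilon> \<le> 1" using assms(2) by simp
  have "(1 - real k * \<epsilon>)\<^sup>2 \<le> 1 - real k * \<epsilon>"
    using assms by (simp add: power2_eq_square mult_left_le)
  also have "\<dots> \<le> (1 - \<epsilon>) ^ k"
    using Bernoulli_inequality[of "- \<epsilon>" k] \<open>\<epsilon> \<le> 1\<close> by simp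
  finally show ?thesis .
qed simp

lemma power_le_power2_one_plus_mult:
  fixes \<epsilon> :: real
  assumes "0 \<le> \<epsilon>" "real k * \<epsilon> \<le> 1"
  shows "(1 + \<epsilon>) ^ k \<le> (1 + real k * \<epsilon>)\<^sup>2"
proof -
  have "(1 + \<epsilon>) ^ k \<le> exp \<epsilon> ^ k"
    using assms(1) by (intro power_mono) auto
  also have "\<dots> = exp (real k * \<epsilon>)" by (simp add: exp_of_nat_mult)
  also have "\<dots> \<le> 1 + real k * \<epsilon> + (real k * \<epsilon>)\<^sup>2"
    using assms by (intro exp_bound) auto
  also have "\<dots> \<le> (1 + real k * \<epsilon>)\<^sup>2"
    using assms(1) by (simp add: power2_sum)
  finally show ?thesis .
qed

lemma linear_bounds_of_power_bounds:
  fixes \<epsilon> S V :: real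
  assumes "0 \<le> \<epsilon>" "real k * \<epsilon> \<le> 1" "0 \<le> S" "0 \<le> V"
    and V: "(1 - \<epsilon>) ^ k * S\<^sup>2 \<le> V\<^sup>2" "V\<^sup>2 \<le> (1 + \<epsilon>) ^ k * S\<^sup>2"
  shows "(1 - real k * \<epsilon>) * S \<le> V" "V \<le> (1 + real k * \<epsilon>) * S"
proof -
  have "((1 - real k * \<epsilon>) * S)\<^sup>2 \<le> (1 - \<epsilon>) ^ k * S\<^sup>2"
    unfolding power_mult_distrib
    by (intro mult_right_mono power2_one_minus_mult_le_power assms zero_le_power2)
  also note V(1)
  finally show "(1 - real k * \<epsilon>) * S \<le> V"
    using assms(4) by (rule power2_le_imp_le)
  note V(2)
  also have "(1 + \<epsilon>) ^ k * S\<^sup>2 \<le> ((1 + real k * \<epsilon>) * S)\<^sup>2"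
    unfolding power_mult_distrib
    by (intro mult_right_mono power_le_power2_one_plus_mult assms zero_le_power2)
  finally show "V \<le> (1 + real k * \<epsilon>) * S"
    by (rule power2_le_imp_le) (use assms in simp)
qed

lemma all_sketch_norm_bounds:
  assumes "0 \<le> \<epsilon>" "real k * \<epsilon> \<le> 1"
    and "\<And>i j. i < k \<Longrightarrow> j \<in> {1..N} \<Longrightarrow> \<not> distorted_level \<epsilon> d \<phi> x i j"
    and "1 \<le> j" "j + 2 ^ k \<le> N + 1"
  shows "(1 - real k * \<epsilon>) * vnorm (window (2 ^ k * d) d x j) \<le> vnorm (all_sketch k d \<phi> x j)"
    and "vnorm (all_sketch k d \<phi> x j) \<le> (1 + real k * \<epsilon>) * vnorm (window (2 ^ k * d) d x j)"
  using all_sketch_level_norm_bounds[OF assms]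
    linear_bounds_of_power_bounds[OF assms(1,2) vnorm_nonneg vnorm_nonneg]
  unfolding all_sketch_def by blast+

lemma prob_distorted_level:
  assumes "jl_distribution d \<epsilon> \<delta> F" "i < k"
  shows "measure_pmf.prob (Pi_pmf {1..k} undefined (\<lambda>_. F)) {\<phi>. distorted_level \<epsilon> d \<phi> x i j} \<le> \<delta>"
proof (rule prob_Pi_pmf_le_conditional)
  show "Suc i \<in> {1..k}" using assms(2) by simp
  fix \<phi> assume \<phi>: "\<phi> \<in> set_pmf (Pi_pmf ({1..k} - {Suc i}) undefined (\<lambda>_. F))"
  have "\<phi> l \<in> carrier_mat d d \<times> carrier_mat d d" if "l \<in> {1..i}" for l
  proof -
    have "l \<in> {1..k} - {Suc i}" using that assms(2) by auto
    then have "\<phi> l \<in> set_pmf F" using \<phi> by (simp add: set_Pi_pmf PiE_dflt_def)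
    then show ?thesis using assms(1) by (auto simp: jl_distribution_def)
  qed
  then have "all_sketch_level d \<phi> x i j' \<in> carrier_vec d" for j'
    by (rule all_sketch_level_carrier)
  moreover have "all_sketch_level d (\<phi>(Suc i := A)) x i j' = all_sketch_level d \<phi> x i j'" for A j'
    by (intro all_sketch_level_cong) auto
  ultimately show "measure_pmf.prob F {A. distorted_level \<epsilon> d (\<phi>(Suc i := A)) x i j} \<le> \<delta>"
    using assms(1) by (simp add: distorted_level_def jl_distribution_def)
qed (use assms(1) in \<open>auto simp: jl_distribution_def\<close>)

lemma prob_all_sketch_norm_bounds:
  assumes "jl_distribution d \<epsilon> \<delta> F" "0 \<le> \<epsilon>" "real k * \<epsilon> \<le> 1" "2 ^ k \<le> N"
  shows "measure_pmf.prob (Pi_pmf {1..k} undefined (\<lambda>_. F)) {\<phi>. \<forall>j\<in>{1..N + 1 - 2 ^ k}.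
      (1 - real k * \<epsilon>) * vnorm (window (2 ^ k * d) d x j) \<le> vnorm (all_sketch k d \<phi> x j) \<and>
      vnorm (all_sketch k d \<phi> x j) \<le> (1 + real k * \<epsilon>) * vnorm (window (2 ^ k * d) d x j)}
    \<ge> 1 - real k * real N * \<delta>" (is "measure_pmf.prob ?P ?E \<ge> _")
proof -
  define bad where "bad = (\<Union>(i, j)\<in>{..<k} \<times> {1..N}. {\<phi>. distorted_level \<epsilon> d \<phi> x i j})"
  have "measure_pmf.prob ?P bad
      \<le> (\<Sum>(i, j)\<in>{..<k} \<times> {1..N}. measure_pmf.prob ?P {\<phi>. distorted_level \<epsilon> d \<phi> x i j})"
    unfolding bad_def case_prod_unfold by (intro measure_UNION_le) auto
  also have "\<dots> \<le> (\<Sum>p\<in>{..<k} \<times> {1..N}. \<delta>)"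
    using prob_distorted_level[OF assms(1)] by (intro sum_mono) (auto simp del: One_nat_def)
  finally have "measure_pmf.prob ?P bad \<le> real k * real N * \<delta>" by simp
  moreover have "measure_pmf.prob ?P (- bad) = 1 - measure_pmf.prob ?P bad"
    using measure_pmf.prob_compl[of bad ?P] by (simp add: Compl_eq_Diff_UNIV)
  moreover have "measure_pmf.prob ?P (- bad) \<le> measure_pmf.prob ?P ?E"
  proof (intro measure_pmf.finite_measure_mono subsetI)
    fix \<phi> assume "\<phi> \<in> - bad"
    then have "\<not> distorted_level \<epsilon> d \<phi> x i j" if "i < k" "j \<in> {1..N}" for i j
      using that by (auto simp: bad_def)
    then show "\<phi> \<in> ?E"
      using all_sketch_norm_bounds[OF assms(2,3), of N d \<phi> x] assms(4) by auto
  qed simp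
  ultimately show ?thesis by linarith
qed

section \<open>The sketches are linear and coincide\<close>

lemma block_offset_less:
  fixes d j l :: nat
  assumes "1 \<le> j" "l < d"
  shows "d * (j - 1) + l < d * j"
  using assms by (cases j) auto

lemma block_window:
  assumes "1 \<le> j" "q \<in> {1..s}"
  shows "block d (window (s * d) d x j) q = block d x (j + (q - 1))"
proof (rule eq_vecI)
  fix l assume "l < dim_vec (block d x (j + (q - 1)))"
  then have l: "l < d" by (simp add: block_def)
  have "d * (q - 1) + l < d * q" using assms l by (intro block_offset_less) auto
  also have "\<dots> \<le> s * d" using assms by simp
  finally have "d * (q - 1) + l < s * d" .
  moreover have "d * (j + (q - 1) - 1) + l = (j - 1) * d + (d * (q - 1) + l)"
    using assms by (cases j; cases q) (simp_all add: algebra_simps)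
  ultimately show "block d (window (s * d) d x j) q $ l = block d x (j + (q - 1)) $ l"
    using l by (simp add: block_def window_def add.assoc)
qed (simp add: block_def)

lemma all_sketch_level_eq_single_sketch_level:
  assumes "1 \<le> j" "1 \<le> q" "q * 2 ^ i \<le> s"
  shows "all_sketch_level d \<phi> x i (j + (q - 1) * 2 ^ i)
    = single_sketch_level d \<phi> (window (s * d) d x j) i q"
  using assms
proof (induction i arbitrary: q)
  case 0
  then show ?case by (simp add: block_window)
next
  case (Suc i)
  obtain q' where q: "q = Suc q'" using Suc.prems by (cases q) auto
  have child: "all_sketch_level d \<phi> x i (j + (p - 1) * 2 ^ i)
      = single_sketch_level d \<phi> (window (s * d) d x j) i p" if "p \<in> {2 * q - 1, 2 * q}" for p
  proof (rule Suc.IH)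
    have "p * 2 ^ i \<le> 2 * q * 2 ^ i" using that by (intro mult_le_mono1) auto
    also have "\<dots> \<le> s" using Suc.prems(3) by (simp add: mult_ac)
    finally show "p * 2 ^ i \<le> s" .
  qed (use that Suc.prems in auto)
  show ?case
    using child[of "2 * q - 1"] child[of "2 * q"] by (simp add: q algebra_simps)
qed

lemma all_sketch_eq_single_sketch:
  assumes "1 \<le> j"
  shows "all_sketch k d \<phi> x j = single_sketch k d \<phi> (window (2 ^ k * d) d x j)"
  using all_sketch_level_eq_single_sketch_level[of j 1 k "2 ^ k" d \<phi> x] assms
  by (simp add: all_sketch_def single_sketch_def)

lemma vec_linear_block:
  assumes "1 \<le> j" "d * j \<le> m"
  shows "vec_linear m d (\<lambda>z. block d z j)"
proof -
  have "d * (j - 1) + l < m" if "l < d" for l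
    using block_offset_less[OF assms(1) that] assms(2) by linarith
  then show ?thesis
    unfolding vec_linear_def by (auto simp: block_def intro!: eq_vecI)
qed

lemma vec_linear_mult_mat_vec:
  assumes "A \<in> carrier_mat d' d" "vec_linear m d f"
  shows "vec_linear m d' (\<lambda>z. A *\<^sub>v f z)"
proof -
  have linear: "f u \<in> carrier_vec d" "f (u + v) = f u + f v" "f (a \<cdot>\<^sub>v u) = a \<cdot>\<^sub>v f u"
    if "u \<in> carrier_vec m" "v \<in> carrier_vec m" for a u v
    using assms(2) that by (simp_all add: vec_linear_def)
  show ?thesis
    unfolding vec_linear_def using assms(1) linear
    by (auto simp: mult_add_distrib_mat_vec[of _ d'] mult_mat_vec[of _ d']
        intro: mult_mat_vec_carrier)
qed

lemma vec_linear_add: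
  assumes "vec_linear m d f" "vec_linear m d g"
  shows "vec_linear m d (\<lambda>z. f z + g z)"
proof -
  have linear: "h u \<in> carrier_vec d" "h (u + v) = h u + h v" "h (a \<cdot>\<^sub>v u) = a \<cdot>\<^sub>v h u"
    if "h \<in> {f, g}" "u \<in> carrier_vec m" "v \<in> carrier_vec m" for h a u v
    using assms that by (auto simp: vec_linear_def)
  have "f u + f v + (g u + g v) = f u + g u + (f v + g v)"
    if "u \<in> carrier_vec m" "v \<in> carrier_vec m" for u v
  proof -
    have "f u \<in> carrier_vec d" "f v \<in> carrier_vec d" "g u \<in> carrier_vec d" "g v \<in> carrier_vec d"
      using linear(1) that by auto
    then show ?thesis by (intro eq_vecI) auto
  qed
  then show ?thesis
    using linear[of f] linear[of g] unfolding vec_linear_def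
    by (simp add: smult_add_distrib_vec[of _ d])
qed

lemma vec_linear_app_map:
  assumes "A \<in> carrier_mat d d \<times> carrier_mat d d" "vec_linear m d f" "vec_linear m d g"
  shows "vec_linear m d (\<lambda>z. app_map A (f z) (g z))"
  unfolding app_map_def using assms by (intro vec_linear_add vec_linear_mult_mat_vec) auto

lemma vec_linear_single_sketch_level:
  assumes "\<And>l. l \<in> {1..i} \<Longrightarrow> \<phi> l \<in> carrier_mat d d \<times> carrier_mat d d"
    and "1 \<le> q" "d * (q * 2 ^ i) \<le> m"
  shows "vec_linear m d (\<lambda>z. single_sketch_level d \<phi> z i q)"
  using assms
proof (induction i arbitrary: q)
  case 0
  then show ?case by (simp add: vec_linear_block)
next
  case (Suc i)
  have "vec_linear m d (\<lambda>z. single_sketch_level d \<phi> z i p)" if "p \<in> {2 * q - 1, 2 * q}" for p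
  proof (rule Suc.IH)
    have "d * (p * 2 ^ i) \<le> d * (2 * q * 2 ^ i)"
      using that by (intro mult_le_mono) auto
    also have "\<dots> \<le> m" using Suc.prems(3) by (simp add: mult_ac)
    finally show "d * (p * 2 ^ i) \<le> m" .
  qed (use that Suc.prems(1,2) in auto)
  then show ?case
    using Suc.prems(1) by (auto intro!: vec_linear_app_map)
qed

lemma vec_linear_single_sketch:
  assumes "\<And>l. l \<in> {1..k} \<Longrightarrow> \<phi> l \<in> carrier_mat d d \<times> carrier_mat d d"
  shows "vec_linear (2 ^ k * d) d (single_sketch k d \<phi>)"
  using vec_linear_single_sketch_level[where i = k and q = 1 and m = "2 ^ k * d", OF assms]
  by (simp add: single_sketch_def[abs_def] mult.commute)

section \<open>The program\<close>

lemma val_bind_tm [simp]: "val (bind_tm p f) = val (f (val p))"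
  and time_bind_tm [simp]: "time (bind_tm p f) = time p + time (f (val p))"
  by (simp_all add: bind_tm_def)

lemma val_return_tm [simp]: "val (return_tm a) = a"
  and time_return_tm [simp]: "time (return_tm a) = 0"
  by (simp_all add: return_tm_def)

lemma primitive_tm_simps [simp]:
  "val (add_tm a b) = a + b" "time (add_tm a b) = 1"
  "val (sub_tm a b) = a - b" "time (sub_tm a b) = 1"
  "val (mul_tm a b) = a * b" "time (mul_tm a b) = 1"
  "val (new_tm l) = 0\<^sub>v l" "time (new_tm l) = l"
  "val (read_tm v p) = v $ p" "time (read_tm v p) = 1"
  "val (write_tm v p x) = vec (dim_vec v) (\<lambda>l. if l = p then x else v $ l)"
  "time (write_tm v p x) = 1"
  for a b :: "'a::{plus,minus,times}"
  by (simp_all add: add_tm_def sub_tm_def mul_tm_def new_tm_def read_tm_def write_tm_def)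

lemma loop_tm_invariant:
  assumes "P 0 st"
    and "\<And>i st. i < length bs \<Longrightarrow> P i st \<Longrightarrow>
      P (Suc i) (val (body (bs ! i) st)) \<and> time (body (bs ! i) st) \<le> T"
  shows "P (length bs) (val (loop_tm bs body st)) \<and> time (loop_tm bs body st) \<le> length bs * (T + 1)"
  using assms
proof (induction bs arbitrary: P st)
  case Nil
  then show ?case by simp
next
  case (Cons b bs)
  let ?st = "val (body b st)"
  have b: "P (Suc 0) ?st" "time (body b st) \<le> T"
    using Cons.prems(2)[of 0 st] Cons.prems(1) by auto
  have "P (Suc (length bs)) (val (loop_tm bs body ?st)) \<and>
      time (loop_tm bs body ?st) \<le> length bs * (T + 1)"
  proof (rule Cons.IH[of "\<lambda>i. P (Suc i)", OF b(1)])
    fix i st assume "i < length bs" "P (Suc i) st"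
    then show "P (Suc (Suc i)) (val (body (bs ! i) st)) \<and> time (body (bs ! i) st) \<le> T"
      using Cons.prems(2)[of "Suc i" st] by simp
  qed
  then show ?case using b(2) by simp
qed

lemma time_mult_add_tm: "time (mult_add_tm E inp src dst out) = 8 * length E"
  unfolding mult_add_tm_def by (induction E arbitrary: out) auto

lemma dim_mult_add_tm [simp]: "dim_vec (val (mult_add_tm E inp src dst out)) = dim_vec out"
  unfolding mult_add_tm_def by (induction E arbitrary: out) auto

lemma val_mult_add_tm:
  assumes "p < dim_vec out"
  shows "val (mult_add_tm E inp src dst out) $ p
    = out $ p + (\<Sum>(i, c, a)\<leftarrow>E. if dst + i = p then a * inp $ (src + c) else 0)"
  using assms unfolding mult_add_tm_def by (induction E arbitrary: out) auto

lemma sum_list_sparse_entries: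
  fixes g :: "nat \<times> nat \<times> real \<Rightarrow> 'a::comm_monoid_add"
  assumes "A \<in> carrier_mat d d"
  shows "sum_list (map g (sparse_entries A))
    = (\<Sum>c<d. \<Sum>i<d. if A $$ (i, c) \<noteq> 0 then g (i, c, A $$ (i, c)) else 0)"
proof -
  have "sum_list (map g (concat xss)) = (\<Sum>xs\<leftarrow>xss. sum_list (map g xs))" for xss
    by (induction xss) auto
  then have "sum_list (map g (sparse_entries A))
    = (\<Sum>c\<leftarrow>[0..<d]. \<Sum>i\<leftarrow>[0..<d]. if A $$ (i, c) \<noteq> 0 then g (i, c, A $$ (i, c)) else 0)"
    using assms unfolding sparse_entries_def
    by (auto simp: comp_def if_distrib[of "map g"] if_distrib[of sum_list] cong: if_cong)
  then show ?thesis
    by (simp add: interv_sum_list_conv_sum_set_nat atLeast0LessThan)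
qed

lemma length_sparse_entries:
  assumes "A \<in> sjl_matrices d r"
  shows "length (sparse_entries A) = d * r"
proof -
  have A: "A \<in> carrier_mat d d" using assms by (simp add: sjl_matrices_def)
  have "length (sparse_entries A) = sum_list (map (\<lambda>_. 1) (sparse_entries A))"
    by (simp add: sum_list_triv)
  also have "\<dots> = (\<Sum>c<d. card {i. i < d \<and> A $$ (i, c) \<noteq> 0})"
    unfolding sum_list_sparse_entries[OF A]
    by (intro sum.cong refl) (simp add: sum.If_cases Int_def)
  also have "\<dots> = d * r"
    using assms by (simp add: sjl_matrices_def)
  finally show ?thesis .
qed

lemma block_mult_add_tm_sparse_entries:
  assumes A: "A \<in> carrier_mat d d" and "1 \<le> j" "d * j \<le> dim_vec out"
  shows "block d (val (mult_add_tm (sparse_entries A) inp (d * p) (d * q) out)) j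
    = (if j = Suc q then block d out j + A *\<^sub>v block d inp (Suc p) else block d out j)"
    (is "?lhs = ?rhs")
proof (rule eq_vecI)
  show dim: "dim_vec ?lhs = dim_vec ?rhs" using A by (simp add: block_def)
  fix l assume "l < dim_vec ?rhs"
  then have l: "l < d" using dim by (simp add: block_def)
  obtain j' where j: "j = Suc j'" using assms(2) by (cases j) auto
  have in_range: "d * j' + l < dim_vec out"
    using block_offset_less[OF assms(2) l] assms(3) by (simp add: j)
  have position: "d * q + i = d * j' + l \<longleftrightarrow> j' = q \<and> i = l" if "i < d" for i
  proof
    assume eq: "d * q + i = d * j' + l"
    have "q = (d * q + i) div d" using that by simp
    also have "\<dots> = j'" unfolding eq using l by simp
    finally show "j' = q \<and> i = l" using eq by simp
  qed simp
  have "(\<Sum>(i, c, a)\<leftarrow>sparse_entries A. if d * q + i = d * j' + l then a * inp $ (d * p + c) else 0)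
    = (\<Sum>c<d. \<Sum>i<d. if i = l then (if j' = q then A $$ (i, c) * inp $ (d * p + c) else 0) else 0)"
    unfolding sum_list_sparse_entries[OF A] by (intro sum.cong refl) (auto simp: position)
  also have "\<dots> = (if j' = q then \<Sum>c<d. A $$ (l, c) * inp $ (d * p + c) else 0)"
    using l by (simp add: sum.delta)
  finally show "?lhs $ l = ?rhs $ l"
    using l A
    by (simp add: j block_def val_mult_add_tm[OF in_range] scalar_prod_def atLeast0LessThan)
qed

definition merge_tm ::
    "nat \<Rightarrow> (nat \<times> nat \<times> real) list \<times> (nat \<times> nat \<times> real) list \<Rightarrow> real vec \<Rightarrow> nat \<Rightarrow>
     nat \<Rightarrow> real vec \<Rightarrow> real vec tm" where
  "merge_tm d = (\<lambda>(E\<^sub>0, E\<^sub>1) cur h j buf. do {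
     p \<leftarrow> mul_tm d j;
     j' \<leftarrow> add_tm j h;
     p' \<leftarrow> mul_tm d j';
     buf \<leftarrow> mult_add_tm E\<^sub>0 cur p p buf;
     mult_add_tm E\<^sub>1 cur p' p buf
   })"

definition level_tm ::
    "nat \<Rightarrow> (nat \<times> nat \<times> real) list \<times> (nat \<times> nat \<times> real) list \<Rightarrow>
     real vec \<times> nat \<times> nat \<Rightarrow> (real vec \<times> nat \<times> nat) tm" where
  "level_tm d E = (\<lambda>(cur, cnt, h). do {
     cnt' \<leftarrow> sub_tm cnt h;
     len \<leftarrow> mul_tm cnt' d;
     buf \<leftarrow> new_tm len;
     buf \<leftarrow> loop_tm [0..<cnt'] (merge_tm d E cur h) buf;
     h' \<leftarrow> mul_tm 2 h;
     return_tm (buf, cnt', h')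
   })"

lemma all_sketch_tm_eq_loop_level_tm: "all_sketch_tm N d Es x = loop_tm Es (level_tm d) (x, N, 1)"
  unfolding all_sketch_tm_def level_tm_def merge_tm_def by (simp add: case_prod_unfold)

definition sparse_pair ::
    "real mat \<times> real mat \<Rightarrow> (nat \<times> nat \<times> real) list \<times> (nat \<times> nat \<times> real) list" where
  "sparse_pair = map_prod sparse_entries sparse_entries"

lemma block_merge_tm:
  assumes "A \<in> carrier_mat d d \<times> carrier_mat d d" "1 \<le> j" "d * j \<le> dim_vec buf"
    and "j = Suc q \<Longrightarrow> block d buf j = 0\<^sub>v d"
  shows "block d (val (merge_tm d (sparse_pair A) cur h q buf)) j
    = (if j = Suc q then app_map A (block d cur j) (block d cur (j + h)) else block d buf j)"
  using assms
  by (cases A) (auto simp: merge_tm_def sparse_pair_def app_map_def block_mult_add_tm_sparse_entries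
      left_zero_vec[of _ d])

lemma time_merge_tm:
  assumes "A \<in> sjl_matrices d r \<times> sjl_matrices d r"
  shows "time (merge_tm d (sparse_pair A) cur h q buf) = 3 + 16 * (d * r)"
  using assms by (auto simp: merge_tm_def sparse_pair_def time_mult_add_tm length_sparse_entries)

lemma merge_loop_tm:
  fixes J h d r :: nat and cur :: "real vec"
  assumes "A \<in> sjl_matrices d r \<times> sjl_matrices d r"
  defines "run \<equiv> loop_tm [0..<J] (merge_tm d (sparse_pair A) cur h) (0\<^sub>v (J * d))"
  shows "dim_vec (val run) = J * d"
    and "\<And>j. j \<in> {1..J} \<Longrightarrow> block d (val run) j = app_map A (block d cur j) (block d cur (j + h))"
    and "time run \<le> J * (4 + 16 * (d * r))"
proof -
  define P where "P q buf \<longleftrightarrow> dim_vec buf = J * d \<and> (\<forall>j\<in>{1..J}. block d buf j =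
    (if j \<le> q then app_map A (block d cur j) (block d cur (j + h)) else 0\<^sub>v d))" for q buf
  have A: "A \<in> carrier_mat d d \<times> carrier_mat d d"
    using assms(1) sjl_matrices_carrier by blast
  have "P (length [0..<J]) (val run) \<and> time run \<le> length [0..<J] * (3 + 16 * (d * r) + 1)"
    unfolding run_def
  proof (rule loop_tm_invariant)
    have "d * (j - 1) + l < J * d" if "j \<in> {1..J}" "l < d" for j l
    proof -
      have "d * (j - 1) + l < d * j" using that by (intro block_offset_less) auto
      also have "\<dots> \<le> J * d" using that by simp
      finally show ?thesis .
    qed
    then show "P 0 (0\<^sub>v (J * d))"
      by (auto simp: P_def block_def intro!: eq_vecI)
    fix q buf assume q: "q < length [0..<J]" "P q buf"
    have "block d (val (merge_tm d (sparse_pair A) cur h q buf)) j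
        = (if j \<le> Suc q then app_map A (block d cur j) (block d cur (j + h)) else 0\<^sub>v d)"
      if "j \<in> {1..J}" for j
      using q(2) that by (subst block_merge_tm[OF A]) (auto simp: P_def mult.commute)
    moreover have "dim_vec (val (merge_tm d (sparse_pair A) cur h q buf)) = J * d"
      using q(2) by (simp add: P_def merge_tm_def sparse_pair_def case_prod_unfold)
    ultimately show "P (Suc q) (val (merge_tm d (sparse_pair A) cur h ([0..<J] ! q) buf)) \<and>
        time (merge_tm d (sparse_pair A) cur h ([0..<J] ! q) buf) \<le> 3 + 16 * (d * r)"
      using q(1) time_merge_tm[OF assms(1)] by (simp add: P_def)
  qed
  then show "dim_vec (val run) = J * d"
    and "\<And>j. j \<in> {1..J} \<Longrightarrow> block d (val run) j = app_map A (block d cur j) (block d cur (j + h))"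
    and "time run \<le> J * (4 + 16 * (d * r))"
    by (auto simp: P_def)
qed

definition level_cost :: "nat \<Rightarrow> nat \<Rightarrow> nat \<Rightarrow> nat" where
  "level_cost N d r = 3 + N * d + N * (4 + 16 * (d * r))"

lemma level_cost_mono: "J \<le> N \<Longrightarrow> level_cost J d r \<le> level_cost N d r"
  unfolding level_cost_def by (intro add_mono mult_le_mono) auto

lemma level_cost_less:
  assumes "0 < N" "0 < d" "0 < r"
  shows "level_cost N d r < 25 * (N * d * r)"
proof -
  have "N \<le> N * d" "N * d \<le> N * d * r" using assms by simp_all
  moreover have "level_cost N d r = 3 + N * d + 4 * N + 16 * (N * d * r)"
    by (simp add: level_cost_def algebra_simps)
  ultimately show ?thesis using assms(1) by linarith
qed

definition stores_level ::
    "nat \<Rightarrow> (nat \<Rightarrow> real mat \<times> real mat) \<Rightarrow> real vec \<Rightarrow> nat \<Rightarrow> nat \<Rightarrow> real vec \<times> nat \<times> nat \<Rightarrow> bool" where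
  "stores_level d \<phi> x N i = (\<lambda>(cur, cnt, h).
     cnt = N + 1 - 2 ^ i \<and> h = 2 ^ i \<and> dim_vec cur = cnt * d \<and>
     (\<forall>j\<in>{1..cnt}. block d cur j = all_sketch_level d \<phi> x i j))"

lemma level_tm_stores_level:
  assumes maps: "\<phi> (Suc i) \<in> sjl_matrices d r \<times> sjl_matrices d r"
    and st: "stores_level d \<phi> x N i st" and pow: "2 ^ Suc i \<le> N"
  defines "run \<equiv> level_tm d (sparse_pair (\<phi> (Suc i))) st"
  shows "stores_level d \<phi> x N (Suc i) (val run)"
    and "time run \<le> level_cost N d r"
proof -
  obtain cur cnt h where st_eq: "st = (cur, cnt, h)" by (cases st)
  define J where "J = N + 1 - 2 ^ Suc i"
  have h: "h = 2 ^ i" and J: "cnt - 2 ^ i = J" "Suc N - 2 * 2 ^ i = J"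
    using st by (auto simp: stores_level_def st_eq J_def mult_2)
  have cur: "block d cur j = all_sketch_level d \<phi> x i j" if "j \<in> {1..N + 1 - 2 ^ i}" for j
    using st that by (auto simp: stores_level_def st_eq)
  note merge = merge_loop_tm[OF maps, where J = J and cur = cur and h = h]
  have "j \<in> {1..N + 1 - 2 ^ i}" "j + 2 ^ i \<in> {1..N + 1 - 2 ^ i}" if "j \<in> {1..J}" for j
    using that pow by (auto simp: J_def)
  then have "app_map (\<phi> (Suc i)) (block d cur j) (block d cur (j + h))
      = all_sketch_level d \<phi> x (Suc i) j" if "j \<in> {1..J}" for j
    using that by (simp add: cur h del: One_nat_def)
  then show "stores_level d \<phi> x N (Suc i) (val run)"
    using merge(1,2) by (simp add: stores_level_def run_def level_tm_def st_eq J h)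
  have "(1::nat) \<le> 2 ^ Suc i" by simp
  then have "J \<le> N" unfolding J_def by linarith
  have "time run \<le> level_cost J d r"
    using merge(3) by (simp add: run_def level_tm_def st_eq J h level_cost_def)
  also have "\<dots> \<le> level_cost N d r"
    using \<open>J \<le> N\<close> by (rule level_cost_mono)
  finally show "time run \<le> level_cost N d r" .
qed

lemma all_sketch_tm_stores_level:
  assumes maps: "\<And>l. l \<in> {1..k} \<Longrightarrow> \<phi> l \<in> sjl_matrices d r \<times> sjl_matrices d r"
    and x: "x \<in> carrier_vec (N * d)" and "2 ^ k \<le> N"
  defines "run \<equiv> all_sketch_tm N d (map (\<lambda>i. sparse_pair (\<phi> i)) [1..<k + 1]) x"
  shows "stores_level d \<phi> x N k (val run) \<and>
    time run \<le> k * (level_cost N d r + 1)"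
proof -
  let ?Es = "map (\<lambda>i. sparse_pair (\<phi> i)) [1..<k + 1]"
  have "stores_level d \<phi> x N (length ?Es) (val (loop_tm ?Es (level_tm d) (x, N, 1))) \<and>
    time (loop_tm ?Es (level_tm d) (x, N, 1))
      \<le> length ?Es * (level_cost N d r + 1)"
  proof (rule loop_tm_invariant)
    show "stores_level d \<phi> x N 0 (x, N, 1)"
      using x by (simp add: stores_level_def)
    fix i st assume i: "i < length ?Es" and st: "stores_level d \<phi> x N i st"
    then have "(2::nat) ^ Suc i \<le> 2 ^ k" by (intro power_increasing) (simp_all del: upt_Suc)
    then have "2 ^ Suc i \<le> N" using assms(3) by linarith
    moreover have "?Es ! i = sparse_pair (\<phi> (Suc i))"
      and "\<phi> (Suc i) \<in> sjl_matrices d r \<times> sjl_matrices d r"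
      using i maps[of "Suc i"] by (simp_all del: upt_Suc)
    ultimately show "stores_level d \<phi> x N (Suc i) (val (level_tm d (?Es ! i) st)) \<and>
        time (level_tm d (?Es ! i) st) \<le> level_cost N d r"
      using level_tm_stores_level st by metis
  qed
  then show ?thesis
    unfolding run_def all_sketch_tm_eq_loop_level_tm by (simp del: upt_Suc)
qed

lemma all_sketch_prog_correct:
  assumes maps: "\<And>l. l \<in> {1..k} \<Longrightarrow> \<phi> l \<in> sjl_matrices d r \<times> sjl_matrices d r"
    and x: "x \<in> carrier_vec (N * d)" and "2 ^ k \<le> N" "0 < d"
  defines "run \<equiv> all_sketch_prog (N * d) k d \<phi> x"
  shows "dim_vec (val run) = (N + 1 - 2 ^ k) * d"
    and "\<And>j. j \<in> {1..N + 1 - 2 ^ k} \<Longrightarrow> block d (val run) j = all_sketch k d \<phi> x j"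
    and "time run \<le> k * (level_cost N d r + 1)"
proof -
  define out where "out = all_sketch_tm N d (map (\<lambda>i. sparse_pair (\<phi> i)) [1..<k + 1]) x"
  have "run = bind_tm out (\<lambda>(out, _, _). return_tm out)"
    using assms(4) by (simp add: run_def all_sketch_prog_def out_def sparse_pair_def)
  moreover have "stores_level d \<phi> x N k (val out)"
    and "time out \<le> k * (level_cost N d r + 1)"
    using all_sketch_tm_stores_level[where \<phi> = \<phi>, OF maps x assms(3)] by (simp_all add: out_def)
  ultimately show "dim_vec (val run) = (N + 1 - 2 ^ k) * d"
    and "\<And>j. j \<in> {1..N + 1 - 2 ^ k} \<Longrightarrow> block d (val run) j = all_sketch k d \<phi> x j"
    and "time run \<le> k * (level_cost N d r + 1)"
    by (auto simp: stores_level_def all_sketch_def case_prod_unfold)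
qed

section \<open>Admissible parameters\<close>

lemma union_bound_le_powr:
  fixes n k N :: nat and c :: real
  assumes "2 \<le> n" "k \<le> n" "N \<le> n"
  shows "real k * real N * (2 * exp (- ((c + 3) * ln n))) \<le> real n powr (- c)"
proof -
  have "exp (- ((c + 3) * ln n)) = real n powr (- (c + 3))"
    using assms(1) by (simp add: powr_def algebra_simps)
  then have "real k * real N * (2 * exp (- ((c + 3) * ln n)))
      \<le> real n * real n * (real n * real n powr (- (c + 3)))"
    using assms by (simp only:) (intro mult_mono, auto)
  also have "\<dots> = real n powr 3 * real n powr (- (c + 3))"
    using assms(1) by (simp add: powr_numeral power3_eq_cube)
  also have "\<dots> = real n powr (- c)"
    unfolding powr_add[symmetric] by simp
  finally show ?thesis .
qed

lemma block_decomposition: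
  fixes n m d k t :: nat
  assumes "0 < d" "m \<le> n" "d dvd m" "d dvd n" "m div d = 2 ^ k" "t = (n - m) div d + 1"
  obtains N where "n = N * d" "m = 2 ^ k * d" "2 ^ k \<le> N" "t = N + 1 - 2 ^ k"
proof
  show n: "n = n div d * d" and m: "m = 2 ^ k * d"
    using assms(3,4) by (simp_all flip: assms(5))
  show le: "2 ^ k \<le> n div d"
    using assms(2,5) div_le_mono by metis
  have "n - m = (n div d - 2 ^ k) * d"
    using n m by (simp add: diff_mult_distrib)
  then show "t = n div d + 1 - 2 ^ k"
    using assms(1,6) le by simp
qed

locale all_sketch_params =
  fixes c \<alpha> \<beta> C\<^sub>0 C\<^sub>1 \<epsilon> :: real and n m d r k t N :: nat
  assumes constants: "0 < c" "0 < \<alpha>" "\<alpha> \<le> \<beta>" "0 < C\<^sub>0" "C\<^sub>0 \<le> C\<^sub>1"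
      "32 * (c + 3) \<le> C\<^sub>0" "8 * (c + 3) \<le> \<alpha> * C\<^sub>0"
    and eps_pos: "0 < \<epsilon>" and d_pos: "0 < d"
    and d_ge: "C\<^sub>0 * ln (real n) / \<epsilon>\<^sup>2 \<le> real d" and d_le: "real d \<le> C\<^sub>1 * ln (real n) / \<epsilon>\<^sup>2"
    and r_ge: "\<alpha> * (real d * \<epsilon>) \<le> real r" and r_le_const: "real r \<le> \<beta> * (real d * \<epsilon>)"
    and r_le_d: "r \<le> d"
    and n_eq: "n = N * d" and m_eq: "m = 2 ^ k * d" and pow_le_N: "2 ^ k \<le> N"
    and t_eq: "t = N + 1 - 2 ^ k" and k_eps: "real k * \<epsilon> \<le> 1"
begin

sublocale sjl_params d r
proof
  have "0 < \<alpha> * (real d * \<epsilon>)" using constants(2) d_pos eps_pos by simp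
  then show "0 < r" using r_ge by linarith
qed (rule r_le_d)

lemma N_le: "N \<le> n" and N_pos: "1 \<le> N" and k_le: "k \<le> n"
proof -
  show "N \<le> n" using d_pos by (simp add: n_eq)
  show "1 \<le> N" using pow_le_N by (metis one_le_numeral one_le_power order_trans)
  show "k \<le> n" using less_exp[of k] pow_le_N \<open>N \<le> n\<close> by linarith
qed

lemma ln_pos: "0 < ln (real n)"
proof -
  have "0 < C\<^sub>1 * ln (real n) / \<epsilon>\<^sup>2" using d_pos d_le by linarith
  then show ?thesis
    using eps_pos constants by (simp add: zero_less_divide_iff zero_less_mult_iff)
qed

lemma n_ge_2: "2 \<le> n"
proof -
  have "n \<noteq> 1" using ln_pos by auto
  then show ?thesis using N_pos N_le by linarith
qed

lemma prob_norm_bounds: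
  "measure_pmf.prob (sketch_maps k d r) {\<phi>. \<forall>j\<in>{1..t}.
      (1 - real k * \<epsilon>) * vnorm (window m d x j) \<le> vnorm (all_sketch k d \<phi> x j) \<and>
      vnorm (all_sketch k d \<phi> x j) \<le> (1 + real k * \<epsilon>) * vnorm (window m d x j)}
    \<ge> 1 - real n powr (- c)" (is "measure_pmf.prob _ ?E \<ge> _")
proof -
  define L where "L = (c + 3) * ln (real n)"
  have "0 < L" using constants(1) ln_pos by (simp add: L_def)
  have d\<epsilon>: "C\<^sub>0 * ln (real n) \<le> real d * \<epsilon>\<^sup>2"
    using d_ge eps_pos by (simp add: pos_divide_le_eq)
  have "32 * L \<le> C\<^sub>0 * ln (real n)"
    using mult_right_mono[OF constants(6), of "ln n"] ln_pos by (simp add: L_def)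
  with d\<epsilon> have d_large: "32 * L \<le> real d * \<epsilon>\<^sup>2" by linarith
  have "8 * L \<le> \<alpha> * (C\<^sub>0 * ln (real n))"
    using mult_right_mono[OF constants(7), of "ln n"] ln_pos by (simp add: L_def)
  also have "\<dots> \<le> \<alpha> * (real d * \<epsilon>\<^sup>2)"
    using d\<epsilon> constants(2) by simp
  also have "\<dots> \<le> real r * \<epsilon>"
    using mult_right_mono[OF r_ge, of \<epsilon>] eps_pos by (simp add: power2_eq_square mult_ac)
  finally have r_large: "8 * L \<le> real r * \<epsilon>" .
  have "1 - real k * real N * (2 * exp (- L)) \<le> measure_pmf.prob (sketch_maps k d r) ?E"
    unfolding sketch_maps_def t_eq m_eq
    using eps_pos k_eps pow_le_N \<open>0 < L\<close> d_large r_large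
    by (intro prob_all_sketch_norm_bounds jl_distribution_sjl_dist) auto
  moreover have "real k * real N * (2 * exp (- L)) \<le> real n powr (- c)"
    unfolding L_def by (intro union_bound_le_powr n_ge_2 k_le N_le)
  ultimately show ?thesis by linarith
qed

lemma k_le_ln: "real k \<le> 2 * ln (real n)"
proof -
  have "real (2 ^ k) \<le> real n"
    using pow_le_N N_le by (intro of_nat_mono) (rule order_trans)
  then have "ln (2 ^ k) \<le> ln (real n)" using n_ge_2 by (subst ln_le_cancel_iff) auto
  then have "real k * ln 2 \<le> ln (real n)" by (simp add: ln_realpow)
  moreover have "real k * (1 / 2) \<le> real k * ln 2"
    using ln2_ge_two_thirds by (intro mult_left_mono) auto
  ultimately show ?thesis by simp
qed

lemma r_le_ln: "real r \<le> \<beta> * C\<^sub>1 * ln (real n) / \<epsilon>"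
proof -
  have "\<beta> * (real d * \<epsilon>) \<le> \<beta> * (C\<^sub>1 * ln (real n) / \<epsilon>\<^sup>2 * \<epsilon>)"
    using d_le eps_pos constants by (intro mult_left_mono mult_right_mono) auto
  also have "\<dots> = \<beta> * C\<^sub>1 * ln (real n) / \<epsilon>"
    using eps_pos by (simp add: power2_eq_square)
  finally show ?thesis using r_le_const by linarith
qed

lemma time_all_sketch_prog_le:
  assumes "\<phi> \<in> set_pmf (sketch_maps k d r)" "x \<in> carrier_vec n"
  shows "real (time (all_sketch_prog n k d \<phi> x)) \<le> 50 * \<beta> * C\<^sub>1 * (real n * (ln (real n))\<^sup>2 / \<epsilon>)"
proof -
  have "time (all_sketch_prog n k d \<phi> x) \<le> k * (level_cost N d r + 1)"
    using assms(2) set_sketch_maps[OF assms(1)] pow_le_N d_pos unfolding n_eq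
    by (intro all_sketch_prog_correct(3))
  also have "\<dots> \<le> k * (25 * (n * r))"
    using level_cost_less[of N d r] N_pos d_pos r_pos by (intro mult_le_mono2) (simp add: n_eq)
  finally have "real (time (all_sketch_prog n k d \<phi> x)) \<le> real (k * (25 * (n * r)))"
    by (rule of_nat_mono)
  also have "\<dots> = real k * (25 * real n * real r)" by simp
  also have "\<dots> \<le> 2 * ln (real n) * (25 * real n * (\<beta> * C\<^sub>1 * ln (real n) / \<epsilon>))"
    using k_le_ln r_le_ln ln_pos by (intro mult_mono) auto
  also have "\<dots> = 50 * \<beta> * C\<^sub>1 * (real n * (ln (real n))\<^sup>2 / \<epsilon>)"
    by (simp add: power2_eq_square)
  finally show ?thesis .
qed

lemma all_sketch_prog_output:
  assumes "\<phi> \<in> set_pmf (sketch_maps k d r)" "x \<in> carrier_vec n"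
  shows "dim_vec (val (all_sketch_prog n k d \<phi> x)) = t * d"
    and "\<And>j. j \<in> {1..t} \<Longrightarrow> block d (val (all_sketch_prog n k d \<phi> x)) j = all_sketch k d \<phi> x j"
proof -
  note prog = all_sketch_prog_correct[where \<phi> = \<phi> and x = x, OF set_sketch_maps[OF assms(1)]
      assms(2)[unfolded n_eq] pow_le_N d_pos, folded n_eq t_eq]
  show "dim_vec (val (all_sketch_prog n k d \<phi> x)) = t * d"
    by (rule prog(1))
  show "\<And>j. j \<in> {1..t} \<Longrightarrow> block d (val (all_sketch_prog n k d \<phi> x)) j = all_sketch k d \<phi> x j"
    by (rule prog(2))
qed

lemma all_sketch_eq_single_sketch_window:
  "j \<in> {1..t} \<Longrightarrow> all_sketch k d \<phi> x j = single_sketch k d \<phi> (window m d x j)"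
  using all_sketch_eq_single_sketch[of j k d \<phi> x] by (simp add: m_eq)

lemma vec_linear_sketch:
  assumes "\<phi> \<in> set_pmf (sketch_maps k d r)"
  shows "vec_linear m d (single_sketch k d \<phi>)"
  unfolding m_eq
proof (rule vec_linear_single_sketch)
  show "\<phi> l \<in> carrier_mat d d \<times> carrier_mat d d" if "l \<in> {1..k}" for l
    using set_sketch_maps[OF assms that] sjl_matrices_carrier[of d r]
    by (simp add: mem_Times_iff subset_iff)
qed

end

theorem theorem9:
  shows "\<exists>K>0. \<forall>c>0. \<forall>\<alpha>>0. \<forall>\<beta>\<ge>\<alpha>. \<exists>C\<^sub>0>0. \<forall>C\<^sub>1\<ge>C\<^sub>0. \<exists>T>0.
    \<forall>(n::nat) (m::nat) (d::nat) (r::nat) (k::nat) (t::nat) (\<epsilon>::real) (x::real vec).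
      0 < \<epsilon> \<longrightarrow> 0 < d \<longrightarrow>
      C\<^sub>0 * ln (real n) / \<epsilon>\<^sup>2 \<le> real d \<longrightarrow> real d \<le> C\<^sub>1 * ln (real n) / \<epsilon>\<^sup>2 \<longrightarrow>
      \<alpha> * (real d * \<epsilon>) \<le> real r \<longrightarrow> real r \<le> \<beta> * (real d * \<epsilon>) \<longrightarrow> r \<le> d \<longrightarrow>
      m \<le> n \<longrightarrow> d dvd m \<longrightarrow> d dvd n \<longrightarrow> m div d = 2 ^ k \<longrightarrow> t = (n - m) div d + 1 \<longrightarrow>
      real k * \<epsilon> \<le> 1 \<longrightarrow> x \<in> carrier_vec n \<longrightarrow>
        measure_pmf.prob (sketch_maps k d r)
          {\<phi>. \<forall>j\<in>{1..t}.
             (1 - K * (real k * \<epsilon>)) * vnorm (window m d x j) \<le> vnorm (all_sketch k d \<phi> x j) \<and>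
             vnorm (all_sketch k d \<phi> x j) \<le> (1 + K * (real k * \<epsilon>)) * vnorm (window m d x j)}
          \<ge> 1 - real n powr (- c) \<and>
        (\<forall>\<phi>\<in>set_pmf (sketch_maps k d r).
           dim_vec (val (all_sketch_prog n k d \<phi> x)) = t * d \<and>
           (\<forall>j\<in>{1..t}. block d (val (all_sketch_prog n k d \<phi> x)) j = all_sketch k d \<phi> x j) \<and>
           real (time (all_sketch_prog n k d \<phi> x)) \<le> T * (real n * (ln (real n))\<^sup>2 / \<epsilon>) \<and>
           (\<forall>j\<in>{1..t}. all_sketch k d \<phi> x j = single_sketch k d \<phi> (window m d x j)) \<and>
           vec_linear m d (single_sketch k d \<phi>))"
proof (rule exI[of _ 1], intro conjI allI impI)
  let "\<exists>K>0. \<forall>c>0. \<forall>\<alpha>>0. \<forall>\<beta>\<ge>\<alpha>. \<exists>C\<^sub>0>0. \<forall>C\<^sub>1\<ge>C\<^sub>0. \<exists>T>0. ?P K c \<alpha> \<beta> C\<^sub>0 C\<^sub>1 T" = ?thesis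
  fix c \<alpha> \<beta> :: real
  assume c: "c > 0" and \<alpha>: "\<alpha> > 0" and \<beta>: "\<beta> \<ge> \<alpha>"
  define C\<^sub>0 where "C\<^sub>0 = 32 * (c + 3) + 8 * (c + 3) / \<alpha>"
  have C\<^sub>0: "C\<^sub>0 > 0" "32 * (c + 3) \<le> C\<^sub>0" "8 * (c + 3) \<le> \<alpha> * C\<^sub>0"
    using c \<alpha> by (auto simp: C\<^sub>0_def field_simps intro!: add_pos_pos)
  have guarantee: "\<exists>T>0. ?P 1 c \<alpha> \<beta> C\<^sub>0 C\<^sub>1 T" if "C\<^sub>1 \<ge> C\<^sub>0" for C\<^sub>1
  proof (intro exI[of _ "50 * \<beta> * C\<^sub>1"] conjI)
    show "50 * \<beta> * C\<^sub>1 > 0" using C\<^sub>0 that \<alpha> \<beta> by simp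
    show "?P 1 c \<alpha> \<beta> C\<^sub>0 C\<^sub>1 (50 * \<beta> * C\<^sub>1)"
    proof (intro allI impI, goal_cases)
      case (1 n m d r k t \<epsilon> x)
      then obtain N where N: "n = N * d" "m = 2 ^ k * d" "2 ^ k \<le> N" "t = N + 1 - 2 ^ k"
        using block_decomposition by blast
      interpret all_sketch_params c \<alpha> \<beta> C\<^sub>0 C\<^sub>1 \<epsilon> n m d r k t N
        by (rule all_sketch_params.intro) (fact c \<alpha> \<beta> C\<^sub>0 that 1 N)+
      show ?case
        using prob_norm_bounds[of x] all_sketch_prog_output[OF _ 1(14)]
          time_all_sketch_prog_le[OF _ 1(14)] all_sketch_eq_single_sketch_window
          vec_linear_sketch by simp
    qed
  qed
  show "\<exists>C\<^sub>0>0. \<forall>C\<^sub>1\<ge>C\<^sub>0. \<exists>T>0. ?P 1 c \<alpha> \<beta> C\<^sub>0 C\<^sub>1 T"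
    by (rule exI[of _ C\<^sub>0]) (intro conjI allI impI C\<^sub>0(1) guarantee)
qed simp

end
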